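(* Let $p\ge 3$ and let $X\sim N_p(\theta,I_p)$ with unknown mean $\theta\in\mathbb{R}^p$. For $a\ge 0$, $b>0$ let $\nu_{a,b}(d\theta)=(a+\|\theta\|^2)^{-b}\,d\theta$. Let $h:\mathbb{R}^p\to[0,\infty)$ be a bounded Borel measurable function and suppose the perturbed prior $\nu_{h,a,b}(d\theta)=h(\theta)\,\nu_{a,b}(d\theta)$ is improper (infinite total mass). If either (A) $a>0$ and $b\in[p/2-1,p/2]$, or (B) $a=0$ and $b\in[p/2-1,p/2)$, then $\nu_{h,a,b}$ is strongly admissible.
   Context: For a statistical model $\{P(\cdot\mid\theta):\theta\in\Theta\}$ on a sample space $\mathcal{X}$ and a $\sigma$-finite measure $\nu$ on $\Theta$, the marginal measure is $M(B)=\int_\Theta P(B\mid\theta)\,\nu(d\theta)$; when $M$ is $\sigma$-finite the formal posterior is a Markov kernel $Q(d\theta\mid x)$ with $P(dx\mid\theta)\nu(d\theta)=Q(d\theta\mid x)M(dx)$ as joint measures. For bounded measurable $\phi:\Theta\to\mathbb{R}$ and estimator $t$, the risk under quadratic loss is $r(t,\theta)=\int (t(x)-\phi(\theta))^2P(dx\mid\theta)$. An estimator $t_0$ is almost-$\nu$-admissible if every estimator $t$ with $r(t,\theta)\le r(t_0,\theta)$ for all $\theta$ satisfies $\nu(\{\theta:r(t,\theta)<r(t_0,\theta)\})=0$. The prior $\nu$ is strongly admissible if for every bounded measurable $\phi$ the formal Bayes estimator $\hat\phi(x)=\int\phi(\theta)Q(d\theta\mid x)$ is almost-$\nu$-admissible.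 *)

theory Defs
  imports "HOL-Probability.Probability"
begin

definition marginal :: "('t \<Rightarrow> 'x measure) \<Rightarrow> 't measure \<Rightarrow> 'x measure \<Rightarrow> 'x measure" where
  "marginal P \<nu> X = measure_of (space X) (sets X) (\<lambda>B. \<integral>\<^sup>+ \<theta>. emeasure (P \<theta>) B \<partial>\<nu>)"

text \<open>Q is a formal posterior: a Markov kernel from X to the parameter space such that
P(dx|theta) nu(dtheta) = Q(dtheta|x) M(dx) as joint measures (checked on rectangles).\<close>

definition is_formal_posterior ::
  "('t \<Rightarrow> 'x measure) \<Rightarrow> 't measure \<Rightarrow> 'x measure \<Rightarrow> ('x \<Rightarrow> 't measure) \<Rightarrow> bool" where
  "is_formal_posterior P \<nu> X Q \<longleftrightarrow>
     (\<forall>x\<in>space X. prob_space (Q x) \<and> sets (Q x) = sets \<nu>) \<and>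
     (\<forall>B\<in>sets \<nu>. (\<lambda>x. emeasure (Q x) B) \<in> borel_measurable X) \<and>
     (\<forall>A\<in>sets X. \<forall>B\<in>sets \<nu>.
        (\<integral>\<^sup>+ \<theta>. indicator B \<theta> * emeasure (P \<theta>) A \<partial>\<nu>)
      = (\<integral>\<^sup>+ x. indicator A x * emeasure (Q x) B \<partial>(marginal P \<nu> X)))"

definition risk :: "('t \<Rightarrow> 'x measure) \<Rightarrow> ('t \<Rightarrow> real) \<Rightarrow> ('x \<Rightarrow> real) \<Rightarrow> 't \<Rightarrow> ennreal" where
  "risk P \<phi> t \<theta> = (\<integral>\<^sup>+ x. ennreal ((t x - \<phi> \<theta>)\<^sup>2) \<partial>(P \<theta>))"

definition almost_admissible ::
  "('t \<Rightarrow> 'x measure) \<Rightarrow> 't measure \<Rightarrow> 'x measure \<Rightarrow> ('t \<Rightarrow> real) \<Rightarrow> ('x \<Rightarrow> real) \<Rightarrow> bool" where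
  "almost_admissible P \<nu> X \<phi> t0 \<longleftrightarrow>
     (\<forall>t \<in> borel_measurable X.
        (\<forall>\<theta>\<in>space \<nu>. risk P \<phi> t \<theta> \<le> risk P \<phi> t0 \<theta>) \<longrightarrow>
        (AE \<theta> in \<nu>. \<not> (risk P \<phi> t \<theta> < risk P \<phi> t0 \<theta>)))"

definition strongly_admissible :: "('t \<Rightarrow> 'x measure) \<Rightarrow> 't measure \<Rightarrow> 'x measure \<Rightarrow> bool" where
  "strongly_admissible P \<nu> X \<longleftrightarrow>
     sigma_finite_measure (marginal P \<nu> X) \<and>
     (\<exists>Q. is_formal_posterior P \<nu> X Q) \<and>
     (\<forall>Q. is_formal_posterior P \<nu> X Q \<longrightarrow>
        (\<forall>\<phi> \<in> borel_measurable \<nu>. (\<exists>B. \<forall>\<theta>\<in>space \<nu>. \<bar>\<phi> \<theta>\<bar> \<le> B) \<longrightarrow>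
           almost_admissible P \<nu> X \<phi> (\<lambda>x. \<integral> \<theta>. \<phi> \<theta> \<partial>(Q x))))"

definition gauss_model :: "real^'n \<Rightarrow> (real^'n) measure" where
  "gauss_model \<theta> = density lborel
     (\<lambda>x. ennreal ((2 * pi) powr (- real CARD('n) / 2) * exp (- (norm (x - \<theta>))\<^sup>2 / 2)))"

definition prior_hab :: "(real^'n \<Rightarrow> real) \<Rightarrow> real \<Rightarrow> real \<Rightarrow> (real^'n) measure" where
  "prior_hab h a b = density lborel (\<lambda>\<theta>. ennreal (h \<theta> * (a + (norm \<theta>)\<^sup>2) powr (- b)))"

end

theory Submission
  imports Defs
begin

text \<open>
  Blyth's method with a logarithmic cutoff. Since \<open>2 b \<ge> p - 2\<close>, the prior
  density is at infinity at most of order \<open>r powr (2 - p)\<close>, so that in polar coordinates it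
  behaves like the recurrent measure \<open>r dr\<close> of the plane. Take
  \<open>u n \<theta> = max 0 (1 - ln (1 + |\<theta>|) / n)\<close>. If \<open>t\<close> dominates the formal Bayes estimator
  \<open>t0\<close> of \<open>\<phi>\<close>, then \<open>t\<close> may be truncated to the range of \<open>\<phi>\<close>, and the risk difference
  integrated against \<open>(u n)\<^sup>2 \<nu>\<close> is at most a constant times the energy
  \<open>\<integral>\<integral> (u n \<theta> - u n x)\<^sup>2 P(dx|\<theta>) \<nu>(d\<theta>)\<close>: the only term not controlled pointwise by the energy is
  linear in \<open>t0(x) - \<phi>(\<theta>)\<close> with a coefficient depending on \<open>x\<close> alone, and it vanishes because
  \<open>t0\<close> is the posterior mean. The integrand of the energy is dominated, uniformly in \<open>n\<close>, by
  \<open>(2 + |x - \<theta>|)^6 / ((1 + |\<theta>|) (1 + ln (1 + |\<theta>|)))\<^sup>2\<close>, which is integrable precisely because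
  \<open>dr / (r (ln r)\<^sup>2)\<close> is, so the energy tends to zero.
\<close>

section \<open>Integrals over Euclidean space\<close>

lemma integrable_lborel_shift:
  fixes g :: "'a::euclidean_space \<Rightarrow> real"
  assumes "integrable lborel g"
  shows "integrable lborel (\<lambda>x. g (x - c))"
    and "(\<integral>x. g (x - c) \<partial>lborel) = (\<integral>x. g x \<partial>lborel)"
proof -
  have [measurable]: "g \<in> borel_measurable borel"
    using borel_measurable_integrable[OF assms] by simp
  have "integrable (distr lborel borel ((+) (- c))) g"
    using assms by (simp add: lborel_distr_plus)
  then show "integrable lborel (\<lambda>x. g (x - c))"
    by (simp add: integrable_distr_eq)
  have "(\<integral>x. g x \<partial>distr lborel borel ((+) (- c))) = (\<integral>x. g (x - c) \<partial>lborel)"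
    by (simp add: integral_distr)
  then show "(\<integral>x. g (x - c) \<partial>lborel) = (\<integral>x. g x \<partial>lborel)"
    by (simp add: lborel_distr_plus)
qed

text \<open>Integrating over \<open>x\<close> first, translation invariance turns the inner integral
  of \<open>\<bar>G\<bar>\<close> into a constant, so a multiple of
  \<open>\<bar>F \<theta>\<bar>\<close> remains.\<close>

lemma integrable_lborel_pair_shift:
  fixes F G :: "'a::euclidean_space \<Rightarrow> real"
  assumes F: "integrable lborel F" and G: "integrable lborel G"
  shows "integrable (lborel \<Otimes>\<^sub>M lborel) (\<lambda>(\<theta>, x). F \<theta> * G (x - \<theta>))"
proof (rule lborel_pair.Fubini_integrable)
  have [measurable]: "F \<in> borel_measurable borel" "G \<in> borel_measurable borel"
    using F G by (auto dest: borel_measurable_integrable)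
  show "(\<lambda>(\<theta>, x). F \<theta> * G (x - \<theta>)) \<in> borel_measurable (lborel \<Otimes>\<^sub>M lborel)"
    by measurable
  show "integrable lborel (\<lambda>\<theta>. \<integral>x. norm (case (\<theta>, x) of (\<theta>, x) \<Rightarrow> F \<theta> * G (x - \<theta>)) \<partial>lborel)"
    using F G integrable_lborel_shift(2)[OF integrable_abs[OF G]]
    by (simp add: abs_mult)
  show "AE \<theta> in lborel. integrable lborel (\<lambda>x. case (\<theta>, x) of (\<theta>, x) \<Rightarrow> F \<theta> * G (x - \<theta>))"
    using integrable_lborel_shift(1)[OF G] by simp
qed

text \<open>A substitute for polar coordinates: \<open>F\<close> is dominated by the sum of the
  constants \<open>c k\<close> on the balls of radius \<open>r k\<close>, whose volumes are
  proportional to \<open>r k ^ DIM('a)\<close>. Layers may overlap; each point with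
  \<open>F x \<noteq> 0\<close> only has to lie in one that bounds it.\<close>

lemma nn_integral_lborel_layers:
  fixes F :: "'a::euclidean_space \<Rightarrow> ennreal" and c r :: "nat \<Rightarrow> real"
  assumes layer: "\<And>x. F x \<noteq> 0 \<Longrightarrow> \<exists>k. norm x < r k \<and> F x \<le> ennreal (c k)"
    and c: "\<And>k. 0 \<le> c k" and r: "\<And>k. 0 \<le> r k"
    and sm: "summable (\<lambda>k. c k * r k ^ DIM('a))"
  shows "(\<integral>\<^sup>+x. F x \<partial>lborel) < \<infinity>"
proof -
  let ?v = "unit_ball_vol (real DIM('a))"
  have v: "0 \<le> ?v" by simp
  have "(\<integral>\<^sup>+x. F x \<partial>lborel) \<le> (\<integral>\<^sup>+x. (\<Sum>k. ennreal (c k) * indicator (ball (0::'a) (r k)) x) \<partial>lborel)"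
  proof (rule nn_integral_mono)
    fix x :: 'a
    obtain k where k: "F x \<le> ennreal (c k) * indicator (ball 0 (r k)) x"
    proof (cases "F x = 0")
      case False
      then obtain k where "norm x < r k" "F x \<le> ennreal (c k)" using layer by blast
      then show thesis by (intro that[of k]) simp
    qed (simp add: that)
    define g where "g j = ennreal (c j) * indicator (ball 0 (r j)) x" for j
    have "F x \<le> g k"
      using k by (simp add: g_def)
    also have "\<dots> = sum g {k}" by simp
    also have "\<dots> \<le> (\<Sum>j. g j)"
      by (rule sum_le_suminf) auto
    finally show "F x \<le> (\<Sum>j. ennreal (c j) * indicator (ball 0 (r j)) x)"
      by (simp add: g_def)
  qed
  also have "\<dots> = (\<Sum>k. ennreal (c k) * emeasure lborel (ball (0::'a) (r k)))"
    by (subst nn_integral_suminf)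
       (auto simp: nn_integral_cmult_indicator intro!: borel_measurable_times_ennreal borel_measurable_indicator)
  also have "\<dots> = (\<Sum>k. ennreal (?v * (c k * r k ^ DIM('a))))"
    by (simp add: emeasure_ball r c ennreal_mult[symmetric] mult_ac)
  also have "\<dots> = ennreal (\<Sum>k. ?v * (c k * r k ^ DIM('a)))"
    using sm r c by (intro suminf_ennreal2 summable_mult) auto
  finally show ?thesis by (simp add: le_less_trans)
qed

lemma integrable_mult_bounded:
  fixes F H :: "'b \<Rightarrow> real"
  assumes F: "integrable M F" and [measurable]: "H \<in> borel_measurable M"
    and H: "\<And>p. \<bar>H p\<bar> \<le> C"
  shows "integrable M (\<lambda>p. F p * H p)"
proof (rule Bochner_Integration.integrable_bound)
  show "integrable M (\<lambda>p. F p * C)"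
    using F by (rule integrable_mult_left)
  show "AE p in M. norm (F p * H p) \<le> norm (F p * C)"
  proof (rule AE_I2)
    fix p
    have "\<bar>H p\<bar> \<le> \<bar>C\<bar>" using H[of p] by linarith
    then show "norm (F p * H p) \<le> norm (F p * C)"
      by (simp add: abs_mult mult_left_mono)
  qed
qed (use F in measurable)

lemma summable_inverse_squares: "summable (\<lambda>k. inverse ((real (Suc k))\<^sup>2))"
  using inverse_power_summable[of 2, where 'a = real] summable_Suc_iff[of "\<lambda>k. inverse ((real k)\<^sup>2)"]
  by simp

text \<open>The layers are indexed by the integer part of the norm. The exponent exceeds the growth
  of the volume by two, which leaves the series of inverse squares.\<close>

lemma nn_integral_polynomial_decay:
  fixes F :: "'a::euclidean_space \<Rightarrow> ennreal"
  assumes F: "\<And>x. F x \<le> ennreal (C / (1 + norm x) ^ (DIM('a) + 2))" and C: "0 \<le> C"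
  shows "(\<integral>\<^sup>+x. F x \<partial>lborel) < \<infinity>"
proof (rule nn_integral_lborel_layers)
  fix x :: 'a
  define j where "j = nat \<lfloor>norm x\<rfloor>"
  have j: "real j \<le> norm x" "norm x < real j + 1" unfolding j_def by (auto simp: of_nat_nat)
  have "C / (1 + norm x) ^ (DIM('a) + 2) \<le> C / (real j + 1) ^ (DIM('a) + 2)"
    using j C by (intro divide_left_mono power_mono mult_pos_pos zero_less_power) (auto simp: add_nonneg_pos)
  then show "\<exists>k. norm x < real k + 1 \<and> F x \<le> ennreal (C / (real k + 1) ^ (DIM('a) + 2))"
    using j F[of x] by (intro exI[of _ j]) (auto intro: order_trans ennreal_leI)
next
  have "summable (\<lambda>k. C * inverse ((real (Suc k))\<^sup>2))"
    by (intro summable_mult summable_inverse_squares)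
  moreover have "C / (real k + 1) ^ (DIM('a) + 2) * (real k + 1) ^ DIM('a) = C * inverse ((real (Suc k))\<^sup>2)" for k
    by (simp add: power_add divide_simps add.commute power2_eq_square)
  ultimately show "summable (\<lambda>k. C / (real k + 1) ^ (DIM('a) + 2) * (real k + 1) ^ DIM('a))"
    by simp
qed (use C in auto)

text \<open>Shells between consecutive powers of 1/e have height of order \<open>exp (s * k)\<close>
  and volume of order \<open>exp (- k * DIM('a))\<close>. The origin has its own bound because
  \<open>0 powr (- s)\<close> is \<open>0\<close>: the bound \<open>near\<close> would force
  \<open>F 0 = 0\<close> there.\<close>

lemma nn_integral_singular_at_origin:
  fixes F :: "'a::euclidean_space \<Rightarrow> ennreal"
  assumes far: "\<And>x. norm x \<ge> 1 \<Longrightarrow> F x = 0" and origin: "F 0 \<le> ennreal C"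
    and near: "\<And>x. x \<noteq> 0 \<Longrightarrow> F x \<le> ennreal (C * norm x powr (- s))"
    and C: "0 \<le> C" and s: "0 \<le> s" "s < real DIM('a)"
  shows "(\<integral>\<^sup>+x. F x \<partial>lborel) < \<infinity>"
proof (rule nn_integral_lborel_layers)
  fix x :: 'a assume "F x \<noteq> 0"
  then have x1: "norm x < 1" using far[of x] by force
  show "\<exists>k. norm x < exp (1 - real k) \<and> F x \<le> ennreal (C * exp (s * (real k + 1)))"
  proof (cases "x = 0")
    case True
    have "C \<le> C * exp (s * (real 0 + 1))" using C s by (simp add: mult_le_cancel_left1)
    then show ?thesis
      using True origin by (intro exI[of _ 0]) (auto intro: order_trans ennreal_leI)
  next
    case False
    define j where "j = nat \<lfloor>- ln (norm x)\<rfloor>"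
    have "0 \<le> - ln (norm x)" using x1 False by (simp add: ln_le_zero_iff)
    then have j: "real j \<le> - ln (norm x)" "- ln (norm x) < real j + 1"
      unfolding j_def by (auto simp: of_nat_nat)
    have "norm x = exp (ln (norm x))" using False by simp
    \<comment> \<open>The radius \<open>exp (1 - real j)\<close> in place of
      \<open>exp (- real j)\<close> gives the strict inequality that an open ball demands; it costs
      only a constant factor.\<close>
    also have "\<dots> < exp (1 - real j)" using j by simp
    finally have 1: "norm x < exp (1 - real j)" .
    have "norm x powr (- s) = exp (s * (- ln (norm x)))" using False by (simp add: powr_def)
    also have "\<dots> \<le> exp (s * (real j + 1))" unfolding exp_le_cancel_iff using j s by (intro mult_left_mono) auto
    finally have "C * norm x powr (- s) \<le> C * exp (s * (real j + 1))" using C by (intro mult_left_mono)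
    then show ?thesis using 1 near[OF False]
      by (intro exI[of _ j]) (auto intro: order_trans ennreal_leI)
  qed
next
  let ?p = "real DIM('a)"
  \<comment> \<open>The series is geometric with ratio \<open>exp (s - ?p)\<close>, below one
    because \<open>s < DIM('a)\<close>.\<close>
  have eq: "C * exp (s * (real k + 1)) * exp (1 - real k) ^ DIM('a) = (C * exp (s + ?p)) * exp (s - ?p) ^ k" for k
    unfolding exp_of_nat_mult[symmetric] mult.assoc exp_add[symmetric] by (simp add: algebra_simps)
  have "summable (\<lambda>k. (C * exp (s + ?p)) * exp (s - ?p) ^ k)"
    using s by (intro summable_mult summable_geometric) simp
  then show "summable (\<lambda>k. C * exp (s * (real k + 1)) * exp (1 - real k) ^ DIM('a))"
    unfolding eq .
qed (use C in auto)

text \<open>The discrete form of the convergence of the integral of dr / (r (1 + ln r)^2): on the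
  shell from exp j to exp (j + 1) the volume cancels \<open>norm x ^ DIM('a)\<close> up to a
  constant and leaves the inverse square of j + 1.\<close>

lemma nn_integral_log_decay:
  fixes F :: "'a::euclidean_space \<Rightarrow> ennreal"
  assumes near: "\<And>x. norm x < 1 \<Longrightarrow> F x = 0"
    and far: "\<And>x. norm x \<ge> 1 \<Longrightarrow> F x \<le> ennreal (C / (norm x ^ DIM('a) * (1 + ln (norm x))\<^sup>2))"
    and C: "0 \<le> C"
  shows "(\<integral>\<^sup>+x. F x \<partial>lborel) < \<infinity>"
proof (rule nn_integral_lborel_layers)
  fix x :: 'a assume "F x \<noteq> 0"
  then have x1: "1 \<le> norm x" using near[of x] by force
  then have x0: "0 < norm x" by linarith
  define j where "j = nat \<lfloor>ln (norm x)\<rfloor>"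
  have "0 \<le> ln (norm x)" using x1 by simp
  then have j: "real j \<le> ln (norm x)" "ln (norm x) < real j + 1"
    unfolding j_def by (auto simp: of_nat_nat)
  have "norm x = exp (ln (norm x))" using x0 by simp
  also have "\<dots> < exp (real j + 1)" using j by simp
  finally have 1: "norm x < exp (real j + 1)" .
  have 2: "exp (real j) \<le> norm x" using j x0 by (simp add: ln_ge_iff)
  have "C / (norm x ^ DIM('a) * (1 + ln (norm x))\<^sup>2) \<le> C / (exp (real j) ^ DIM('a) * (1 + real j)\<^sup>2)"
    using j 2 C x0 by (intro divide_left_mono mult_mono power_mono mult_pos_pos zero_less_power) auto
  then show "\<exists>k. norm x < exp (real k + 1) \<and> F x \<le> ennreal (C / (exp (real k) ^ DIM('a) * (1 + real k)\<^sup>2))"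
    using 1 far[OF x1] by (intro exI[of _ j]) (auto intro: order_trans ennreal_leI)
next
  have "summable (\<lambda>k. (C * exp 1 ^ DIM('a)) * inverse ((real (Suc k))\<^sup>2))"
    by (intro summable_mult summable_inverse_squares)
  moreover have "C / (exp (real k) ^ DIM('a) * (1 + real k)\<^sup>2) * exp (real k + 1) ^ DIM('a)
      = (C * exp 1 ^ DIM('a)) * inverse ((real (Suc k))\<^sup>2)" for k
    by (simp add: exp_add power_mult_distrib divide_simps)
  ultimately show "summable (\<lambda>k. C / (exp (real k) ^ DIM('a) * (1 + real k)\<^sup>2) * exp (real k + 1) ^ DIM('a))"
    by simp
qed (use C in auto)

section \<open>Gaussian moments\<close>

lemma polynomial_gaussian_le:
  assumes r: "0 \<le> (r::real)"
  shows "(2 + r) ^ N * exp (- r\<^sup>2 / 2) \<le> exp (2 * real N + (real N)\<^sup>2 / 2)"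
proof -
  \<comment> \<open>This crude bound turns the polynomial into an exponential whose exponent is
    linear in \<open>r\<close>, to be beaten by the quadratic one.\<close>
  have "2 + r \<le> exp (2 + r)" using exp_ge_add_one_self[of "2 + r"] by linarith
  then have "(2 + r) ^ N \<le> exp (real N * (2 + r))"
    using power_mono[of "2 + r" "exp (2 + r)" N] r by (simp add: exp_of_nat_mult)
  then have "(2 + r) ^ N * exp (- r\<^sup>2 / 2) \<le> exp (real N * (2 + r)) * exp (- r\<^sup>2 / 2)"
    by (rule mult_right_mono) simp
  also have "\<dots> = exp (real N * (2 + r) - r\<^sup>2 / 2)"
    by (simp add: exp_add[symmetric])
  also have "\<dots> \<le> exp (2 * real N + (real N)\<^sup>2 / 2)"
  proof -
    \<comment> \<open>Completing the square bounds N r - r^2/2 by N^2/2.\<close>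
    have "0 \<le> (real N - r)\<^sup>2" by simp
    then show ?thesis by (simp add: power2_eq_square algebra_simps)
  qed
  finally show ?thesis .
qed

lemma gaussian_moment_integrable:
  fixes c :: real
  assumes c: "0 \<le> c"
  shows "integrable lborel (\<lambda>z::'a::euclidean_space. (2 + norm z) ^ N * (c * exp (- (norm z)\<^sup>2 / 2)))"
proof (rule integrableI_bounded)
  \<comment> \<open>The moment of order \<open>N\<close> is joined with the factor of order
    \<open>DIM('a) + 2\<close> that the decay criterion demands; the Gaussian absorbs both powers at
    once.\<close>
  let ?M = "N + (DIM('a) + 2)"
  let ?C = "c * exp (2 * real ?M + (real ?M)\<^sup>2 / 2)"
  show "(\<integral>\<^sup>+z. ennreal (norm ((2 + norm (z :: 'a)) ^ N * (c * exp (- (norm z)\<^sup>2 / 2)))) \<partial>lborel) < \<infinity>"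
  proof (rule nn_integral_polynomial_decay)
    fix z :: 'a
    have p: "0 < (1 + norm z) ^ (DIM('a) + 2)" by (intro zero_less_power) (simp add: add_pos_nonneg)
    have "(2 + norm z) ^ N * (c * exp (- (norm z)\<^sup>2 / 2)) * (1 + norm z) ^ (DIM('a) + 2)
      \<le> (2 + norm z) ^ N * (c * exp (- (norm z)\<^sup>2 / 2)) * (2 + norm z) ^ (DIM('a) + 2)"
      using c by (intro mult_left_mono power_mono) auto
    also have "\<dots> = c * ((2 + norm z) ^ ?M * exp (- (norm z)\<^sup>2 / 2))"
      by (simp only: power_add mult_ac)
    also have "\<dots> \<le> ?C"
      using c by (intro mult_left_mono polynomial_gaussian_le) auto
    finally have "(2 + norm z) ^ N * (c * exp (- (norm z)\<^sup>2 / 2)) \<le> ?C / (1 + norm z) ^ (DIM('a) + 2)"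
      using p by (simp add: pos_le_divide_eq)
    moreover have "0 \<le> (2 + norm z) ^ N * (c * exp (- (norm z)\<^sup>2 / 2))" using c by simp
    ultimately show "ennreal (norm ((2 + norm z) ^ N * (c * exp (- (norm z)\<^sup>2 / 2))))
        \<le> ennreal (?C / (1 + norm z) ^ (DIM('a) + 2))"
      by (metis abs_of_nonneg ennreal_leI real_norm_def)
  qed (use c in simp)
qed measurable

section \<open>The logarithmic cutoff\<close>

abbreviation lnorm :: "'a::real_normed_vector \<Rightarrow> real" where
  "lnorm \<theta> \<equiv> ln (1 + norm \<theta>)"

text \<open>A logarithmic ramp: for \<open>n > 0\<close> it falls from 1 at the origin to 0 where
  \<open>1 + norm \<theta>\<close> reaches \<open>exp n\<close>. For \<open>n = 0\<close> division
  by zero makes it constantly 1, whence the hypotheses \<open>n > 0\<close> and the index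
  \<open>Suc n\<close> below.\<close>

definition cutoff :: "nat \<Rightarrow> 'a::real_normed_vector \<Rightarrow> real" where
  "cutoff n \<theta> = max 0 (1 - lnorm \<theta> / real n)"

text \<open>The part depending on \<open>\<theta>\<close> in the bound for squared increments of the
  cutoff, uniform in \<open>n\<close>. Against a radial density of order r dr it yields dr / (r (ln
  r)^2) at infinity.\<close>

definition log_weight :: "'a::real_normed_vector \<Rightarrow> real" where
  "log_weight \<theta> = 1 / ((1 + norm \<theta>) * (1 + lnorm \<theta>))\<^sup>2"

section \<open>Increments of the logarithm and of the cutoff\<close>

lemma lnorm_nonneg: "0 \<le> lnorm \<theta>"
  by simp

lemma lnorm_diff_le: "lnorm x - lnorm \<theta> \<le> norm (x - \<theta>) / (1 + norm \<theta>)"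
proof -
  have p: "1 + norm \<theta> \<noteq> 0" using norm_ge_zero[of \<theta>] by linarith
  have "lnorm x - lnorm \<theta> = ln ((1 + norm x) / (1 + norm \<theta>))"
    by (rule ln_divide_pos[symmetric]) (auto simp: add_pos_nonneg)
  also have "\<dots> \<le> (1 + norm x) / (1 + norm \<theta>) - 1"
    by (intro ln_le_minus_one divide_pos_pos) (auto simp: add_pos_nonneg)
  also have "\<dots> = (norm x - norm \<theta>) / (1 + norm \<theta>)"
    using p by (simp add: divide_diff_eq_iff)
  also have "\<dots> \<le> norm (x - \<theta>) / (1 + norm \<theta>)"
    by (intro divide_right_mono norm_triangle_ineq2) auto
  finally show ?thesis .
qed

text \<open>Moves a power of the weight from \<open>\<theta>\<close> to \<open>x\<close>; the price
  is a power of \<open>1 + norm (x - \<theta>)\<close>, which the decay of the kernel pays.\<close>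

lemma one_plus_norm_peetre: "1 + norm \<theta> \<le> (1 + norm x) * (1 + norm (x - \<theta>))"
proof -
  have "norm \<theta> \<le> norm x + norm (x - \<theta>)"
    by (metis norm_minus_commute norm_triangle_sub)
  moreover have "0 \<le> norm x * norm (x - \<theta>)" by simp
  ultimately have "norm \<theta> \<le> norm x + norm (x - \<theta>) + norm x * norm (x - \<theta>)" by linarith
  then show ?thesis by (simp add: algebra_simps)
qed

lemma abs_lnorm_diff_le:
  "\<bar>lnorm \<theta> - lnorm x\<bar> \<le> norm (x - \<theta>) * (1 + norm (x - \<theta>)) / (1 + norm \<theta>)"
proof -
  let ?z = "norm (x - \<theta>)"
  have p: "0 < 1 + norm \<theta>" "0 < 1 + norm x" by (auto simp: add_pos_nonneg)
  have "lnorm x - lnorm \<theta> \<le> ?z / (1 + norm \<theta>)" by (rule lnorm_diff_le)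
  also have "\<dots> \<le> ?z * (1 + ?z) / (1 + norm \<theta>)"
    using p by (intro divide_right_mono) (auto simp: mult_le_cancel_left1)
  finally have 1: "lnorm x - lnorm \<theta> \<le> ?z * (1 + ?z) / (1 + norm \<theta>)" .
  \<comment> \<open>For this sign the tangent bound has the wrong base point in its denominator; the
    Peetre inequality replaces \<open>x\<close> by \<open>\<theta>\<close>.\<close>
  have "lnorm \<theta> - lnorm x \<le> ?z / (1 + norm x)"
    using lnorm_diff_le[of \<theta> x] by (simp add: norm_minus_commute)
  also have "\<dots> \<le> ?z * (1 + ?z) / (1 + norm \<theta>)"
  proof -
    have "?z * (1 + norm \<theta>) \<le> ?z * ((1 + norm x) * (1 + ?z))"
      using one_plus_norm_peetre[of \<theta> x] by (intro mult_left_mono) auto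
    then show ?thesis using p by (simp add: divide_simps mult_ac)
  qed
  finally show ?thesis using 1 by linarith
qed

lemma cutoff_bounds: "0 \<le> cutoff n \<theta>" "cutoff n \<theta> \<le> 1"
  by (auto simp: cutoff_def)

lemma cutoff_tendsto: "(\<lambda>n. cutoff n \<theta>) \<longlonglongrightarrow> 1"
proof -
  have "(\<lambda>n. max 0 (1 - lnorm \<theta> / real n)) \<longlonglongrightarrow> max 0 (1 - 0)"
    by (intro tendsto_intros lim_const_over_n)
  then show ?thesis by (simp add: cutoff_def)
qed

text \<open>The cutoff is a 1/n-Lipschitz function of \<open>lnorm\<close>, and the factor 1/n must
  be traded for 1 / (1 + lnorm \<theta>). If both points lie outside the support, the increment is
  zero; otherwise \<open>lnorm \<theta>\<close> exceeds \<open>n\<close> by at most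
  \<open>norm (x - \<theta>)\<close>.\<close>

lemma cutoff_diff_le:
  fixes \<theta> x :: "'a::real_normed_vector"
  assumes n: "n > 0"
  shows "\<bar>cutoff n \<theta> - cutoff n x\<bar> \<le> (2 + norm (x - \<theta>)) ^ 3 / ((1 + norm \<theta>) * (1 + lnorm \<theta>))"
proof (cases "lnorm \<theta> \<ge> n \<and> lnorm x \<ge> n")
  case True
  then have "cutoff n \<theta> = 0" "cutoff n x = 0"
    using n by (auto simp: cutoff_def max_def divide_simps)
  then show ?thesis using lnorm_nonneg[of \<theta>] by simp
next
  case False
  let ?z = "norm (x - \<theta>)"
  have L: "0 \<le> lnorm \<theta>" "0 \<le> lnorm x" by simp_all
  have p: "0 < 1 + norm \<theta>" by (auto simp: add_pos_nonneg)
  have n1: "1 \<le> real n" using n by simp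
  have "lnorm \<theta> - lnorm x \<le> ln (1 + ?z)"
  proof -
    have "lnorm \<theta> \<le> ln ((1 + norm x) * (1 + ?z))"
      using one_plus_norm_peetre[of \<theta> x] p by (subst ln_le_cancel_iff) (auto simp: add_pos_nonneg)
    also have "\<dots> = lnorm x + ln (1 + ?z)"
      by (rule ln_mult_pos) (auto simp: add_pos_nonneg)
    finally show ?thesis by simp
  qed
  moreover have "ln (1 + ?z) \<le> ?z" by (rule ln_add_one_self_le_self) simp
  \<comment> \<open>One of the two points has \<open>lnorm\<close> below \<open>n\<close>; if it is
    \<open>x\<close>, the preceding bound carries the estimate over to
    \<open>\<theta>\<close>.\<close>
  ultimately have "1 + lnorm \<theta> \<le> 1 + real n + ?z"
    using False norm_ge_zero[of "x - \<theta>"] by linarith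
  also have "\<dots> \<le> real n * (2 + ?z)"
    using mult_right_mono[OF n1, of "1 + ?z"] n1 by (simp add: algebra_simps)
  finally have inv: "1 / real n \<le> (2 + ?z) / (1 + lnorm \<theta>)"
    using n1 add_pos_nonneg[OF zero_less_one L(1)]
    by (simp add: pos_divide_le_eq pos_le_divide_eq mult_ac)
  have "\<bar>cutoff n \<theta> - cutoff n x\<bar> \<le> \<bar>(1 - lnorm \<theta> / n) - (1 - lnorm x / n)\<bar>"
    unfolding cutoff_def by linarith
  also have "\<dots> = \<bar>lnorm \<theta> - lnorm x\<bar> * (1 / real n)"
    using n by (simp add: abs_if field_simps)
  also have "\<dots> \<le> (?z * (1 + ?z) / (1 + norm \<theta>)) * ((2 + ?z) / (1 + lnorm \<theta>))"
    by (intro mult_mono abs_lnorm_diff_le inv) auto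
  also have "\<dots> = (?z * (1 + ?z) * (2 + ?z)) / ((1 + norm \<theta>) * (1 + lnorm \<theta>))"
    by simp
  also have "\<dots> \<le> (2 + ?z) ^ 3 / ((1 + norm \<theta>) * (1 + lnorm \<theta>))"
  proof (rule divide_right_mono)
    show "?z * (1 + ?z) * (2 + ?z) \<le> (2 + ?z) ^ 3"
      by (simp add: power3_eq_cube) (intro mult_mono, auto)
  qed (use p L in auto)
  finally show ?thesis .
qed

lemma cutoff_diff_square_le:
  fixes \<theta> x :: "'a::real_normed_vector"
  assumes "n > 0"
  shows "(cutoff n \<theta> - cutoff n x)\<^sup>2 \<le> (2 + norm (x - \<theta>)) ^ 6 * log_weight \<theta>"
proof -
  have "(cutoff n \<theta> - cutoff n x)\<^sup>2 \<le> ((2 + norm (x - \<theta>)) ^ 3 / ((1 + norm \<theta>) * (1 + lnorm \<theta>)))\<^sup>2"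
    using power_mono[OF cutoff_diff_le[OF assms, of \<theta> x], of 2] by simp
  then show ?thesis
    by (simp add: log_weight_def power_divide power_mult[symmetric])
qed

lemma log_weight_pos: "0 < log_weight \<theta>"
proof -
  have "0 < (1 + norm \<theta>) * (1 + lnorm \<theta>)"
    by (intro mult_pos_pos add_pos_nonneg) auto
  then show ?thesis unfolding log_weight_def
    by (intro divide_pos_pos) auto
qed

text \<open>By ln (1 + r) \<le> r the weight decays no faster than the inverse fourth power.
  Integrability against \<open>log_weight\<close> thus passes to every weight with decay of order
  four.\<close>

lemma log_weight_lower: "1 \<le> (1 + norm \<theta>) ^ 4 * log_weight \<theta>"
proof -
  have p: "0 < 1 + norm \<theta>" "0 < 1 + lnorm \<theta>" by (auto simp: add_pos_nonneg)
  have "lnorm \<theta> \<le> norm \<theta>" by (rule ln_add_one_self_le_self) simp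
  then have "(1 + norm \<theta>) * (1 + lnorm \<theta>) \<le> (1 + norm \<theta>) * (1 + norm \<theta>)"
    using p by (intro mult_left_mono) auto
  then have "((1 + norm \<theta>) * (1 + lnorm \<theta>))\<^sup>2 \<le> ((1 + norm \<theta>)\<^sup>2)\<^sup>2"
    using p by (intro power_mono) (auto simp: power2_eq_square)
  moreover have "0 < ((1 + norm \<theta>) * (1 + lnorm \<theta>))\<^sup>2"
    using p by (intro zero_less_power mult_pos_pos) auto
  ultimately show ?thesis by (simp add: log_weight_def)
qed

text \<open>On the support \<open>1 + norm \<theta>\<close> is at most \<open>exp n\<close>, so the
  weight is at least \<open>exp (- 4 * n)\<close> there. This makes the prior finite after
  multiplication by the squared cutoff.\<close>

lemma cutoff_square_le:
  assumes "n > 0"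
  shows "(cutoff n \<theta>)\<^sup>2 \<le> exp (4 * real n) * log_weight \<theta>"
proof (cases "lnorm \<theta> \<ge> n")
  case True
  then have "cutoff n \<theta> = 0"
    using assms by (auto simp: cutoff_def max_def divide_simps)
  then show ?thesis using log_weight_pos[of \<theta>] by simp
next
  case False
  then have "1 + norm \<theta> \<le> exp n"
    by (metis add_pos_nonneg exp_le_cancel_iff exp_ln linear norm_ge_zero zero_less_one)
  then have "(1 + norm \<theta>) ^ 4 \<le> exp n ^ 4"
    by (intro power_mono) auto
  then have "(1 + norm \<theta>) ^ 4 \<le> exp (4 * real n)"
    by (simp add: exp_of_nat_mult[symmetric])
  then have "(1 + norm \<theta>) ^ 4 * log_weight \<theta> \<le> exp (4 * real n) * log_weight \<theta>"
    using log_weight_pos[of \<theta>] by (intro mult_right_mono) auto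
  moreover have "(cutoff n \<theta>)\<^sup>2 \<le> 1"
    using cutoff_bounds[of n \<theta>] by (simp add: power_le_one)
  ultimately show ?thesis using log_weight_lower[of \<theta>] by linarith
qed

lemma cutoff_measurable[measurable]:
  "(cutoff n :: 'a::{real_normed_vector, second_countable_topology} \<Rightarrow> real) \<in> borel_measurable borel"
  unfolding cutoff_def[abs_def] by measurable

lemma log_weight_measurable[measurable]:
  "(log_weight :: 'a::{real_normed_vector, second_countable_topology} \<Rightarrow> real) \<in> borel_measurable borel"
  unfolding log_weight_def[abs_def] by measurable

section \<open>Integrability of the prior against the logarithmic weight\<close>

lemma log_weight_le: "log_weight \<theta> \<le> 1"
proof -
  have "1 * 1 \<le> (1 + norm \<theta>) * (1 + lnorm \<theta>)"
    using lnorm_nonneg[of \<theta>] by (intro mult_mono) auto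
  then have "1 \<le> ((1 + norm \<theta>) * (1 + lnorm \<theta>))\<^sup>2" by (simp add: one_le_power)
  then have "1 / ((1 + norm \<theta>) * (1 + lnorm \<theta>))\<^sup>2 \<le> 1 / 1" by (intro divide_left_mono) auto
  then show ?thesis by (simp add: log_weight_def)
qed

lemma log_weight_far_le:
  assumes "norm \<theta> \<ge> 1"
  shows "log_weight \<theta> \<le> 1 / ((norm \<theta>)\<^sup>2 * (1 + ln (norm \<theta>))\<^sup>2)"
proof -
  have t: "0 < norm \<theta>" "0 \<le> ln (norm \<theta>)" using assms by (auto intro: less_le_trans[OF zero_less_one])
  have q: "0 < 1 + norm \<theta>" "0 < 1 + lnorm \<theta>" "0 < 1 + ln (norm \<theta>)"
    using t lnorm_nonneg[of \<theta>] by linarith+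
  have "ln (norm \<theta>) \<le> lnorm \<theta>" using t(1) by (subst ln_le_cancel_iff) (auto simp: add_pos_nonneg)
  then have "norm \<theta> * (1 + ln (norm \<theta>)) \<le> (1 + norm \<theta>) * (1 + lnorm \<theta>)"
    using t by (intro mult_mono) auto
  then have "(norm \<theta> * (1 + ln (norm \<theta>)))\<^sup>2 \<le> ((1 + norm \<theta>) * (1 + lnorm \<theta>))\<^sup>2"
    using t by (intro power_mono) auto
  moreover have "0 < ((1 + norm \<theta>) * (1 + lnorm \<theta>))\<^sup>2 * (norm \<theta> * (1 + ln (norm \<theta>)))\<^sup>2"
    by (intro mult_pos_pos zero_less_power t q)
  ultimately show ?thesis unfolding log_weight_def power_mult_distrib[symmetric]
    by (intro divide_left_mono) simp_all
qed

text \<open>Split at the unit sphere. Inside, the weight is at most 1 and the density is bounded or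
  has a singularity of order 2b below the dimension. Outside, the weight supplies the two powers of
  the norm by which the density may fall short of the critical decay, and the squared logarithm
  gives convergence.\<close>

lemma prior_weight_integrable:
  fixes h :: "'a::euclidean_space \<Rightarrow> real"
  assumes [measurable]: "h \<in> borel_measurable borel"
    and h0: "\<And>\<theta>. 0 \<le> h \<theta>" and hC: "\<And>\<theta>. h \<theta> \<le> C"
    and a: "0 \<le> a" and b: "0 < b" "real DIM('a) - 2 \<le> 2 * b"
    and ab: "0 < a \<or> 2 * b < real DIM('a)"
  shows "integrable lborel (\<lambda>\<theta>. h \<theta> * (a + (norm \<theta>)\<^sup>2) powr (- b) * log_weight \<theta>)"
proof (rule integrableI_bounded)
  define g where "g \<theta> = h \<theta> * (a + (norm \<theta>)\<^sup>2) powr (- b) * log_weight \<theta>" for \<theta> :: 'a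
  have [measurable]: "g \<in> borel_measurable borel" unfolding g_def[abs_def] by measurable
  have C: "0 \<le> C" using h0[of 0] hC[of 0] by linarith
  have g0: "0 \<le> g \<theta>" for \<theta> using h0[of \<theta>] log_weight_pos[of \<theta>] by (simp add: g_def)
  have g_le: "g \<theta> \<le> C * (a + (norm \<theta>)\<^sup>2) powr (- b)" for \<theta>
  proof -
    have "g \<theta> \<le> C * (a + (norm \<theta>)\<^sup>2) powr (- b) * 1"
      unfolding g_def using C hC[of \<theta>] log_weight_le[of \<theta>] log_weight_pos[of \<theta>]
      by (intro mult_mono) auto
    then show ?thesis by simp
  qed
  have pow: "(a + (norm \<theta>)\<^sup>2) powr (- b) \<le> norm \<theta> powr (- (2 * b))" if "\<theta> \<noteq> 0" for \<theta> :: 'a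
  proof -
    have "(a + (norm \<theta>)\<^sup>2) powr (- b) \<le> ((norm \<theta>)\<^sup>2) powr (- b)"
      using that a b by (intro powr_mono2') auto
    also have "((norm \<theta>)\<^sup>2) powr (- b) = (norm \<theta> powr 2) powr (- b)"
      using that by (simp add: powr_numeral)
    also have "\<dots> = norm \<theta> powr (- (2 * b))"
      by (simp only: powr_powr) simp
    finally show ?thesis .
  qed
  have "(\<integral>\<^sup>+\<theta>. ennreal (g \<theta>) * indicator (ball 0 1) \<theta> \<partial>lborel) < \<infinity>"
  proof (cases "a > 0")
    case True
    have *: "g \<theta> \<le> C * a powr (- b)" for \<theta>
    proof -
      have "(a + (norm \<theta>)\<^sup>2) powr (- b) \<le> a powr (- b)"
        using True b by (intro powr_mono2') auto
      then show ?thesis using g_le[of \<theta>] C by (meson mult_left_mono order_trans)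
    qed
    show ?thesis
    \<comment> \<open>The density is bounded near the origin, so the criterion is used with exponent
      0.\<close>
    proof (rule nn_integral_singular_at_origin)
      show "ennreal (g \<theta>) * indicator (ball 0 1) \<theta> = 0" if "norm \<theta> \<ge> 1" for \<theta> :: 'a
        using that by (simp add: indicator_def)
      show "ennreal (g \<theta>) * indicator (ball 0 1) \<theta> \<le> ennreal ((C * a powr (- b)) * norm \<theta> powr (- 0))"
        if "\<theta> \<noteq> 0" for \<theta> :: 'a
        using that *[of \<theta>] by (simp add: indicator_def ennreal_leI)
      show "ennreal (g 0) * indicator (ball 0 1) (0::'a) \<le> ennreal (C * a powr (- b))"
        using *[of 0] by (simp add: indicator_def ennreal_leI)
    qed (use C in auto)
  next
    case False
    then have a0: "a = 0" using a by simp
    \<comment> \<open>The singular density takes the value 0 at the origin, since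
      \<open>0 powr (- b)\<close> is \<open>0\<close>.\<close>
    have 0: "g 0 = 0" by (simp add: g_def a0)
    show ?thesis
    proof (rule nn_integral_singular_at_origin)
      show "ennreal (g \<theta>) * indicator (ball 0 1) \<theta> = 0" if "norm \<theta> \<ge> 1" for \<theta> :: 'a
        using that by (simp add: indicator_def)
      show "ennreal (g \<theta>) * indicator (ball 0 1) \<theta> \<le> ennreal (C * norm \<theta> powr (- (2 * b)))"
        if "\<theta> \<noteq> 0" for \<theta> :: 'a
      proof -
        have "g \<theta> \<le> C * norm \<theta> powr (- (2 * b))"
          using g_le[of \<theta>] pow[OF that] C by (meson mult_left_mono order_trans)
        then show ?thesis by (simp add: indicator_def ennreal_leI)
      qed
      show "ennreal (g 0) * indicator (ball 0 1) (0::'a) \<le> ennreal C" by (simp add: 0)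
    qed (use C b ab False in auto)
  qed
  moreover have "(\<integral>\<^sup>+\<theta>. ennreal (g \<theta>) * indicator (- ball 0 1) \<theta> \<partial>lborel) < \<infinity>"
  proof (rule nn_integral_log_decay)
    show "ennreal (g \<theta>) * indicator (- ball 0 1) \<theta> = 0" if "norm \<theta> < 1" for \<theta> :: 'a
      using that by (simp add: indicator_def)
    fix \<theta> :: 'a assume t1: "1 \<le> norm \<theta>"
    let ?D = "DIM('a)"
    have t0: "0 < norm \<theta>" and tn: "\<theta> \<noteq> 0" using t1 by auto
    \<comment> \<open>The lower bound on \<open>b\<close> enters here: the density is at most of
      order r^(2 - p) at infinity.\<close>
    have "norm \<theta> powr (- (2 * b)) \<le> norm \<theta> powr (2 - real ?D)"
      using t1 b by (intro powr_mono) auto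
    also have "\<dots> = (norm \<theta>)\<^sup>2 / norm \<theta> ^ ?D"
      using t0 by (simp add: powr_diff powr_realpow)
    finally have le: "(a + (norm \<theta>)\<^sup>2) powr (- b) \<le> (norm \<theta>)\<^sup>2 / norm \<theta> ^ ?D"
      using pow[OF tn] by linarith
    have "g \<theta> \<le> C * ((norm \<theta>)\<^sup>2 / norm \<theta> ^ ?D) * (1 / ((norm \<theta>)\<^sup>2 * (1 + ln (norm \<theta>))\<^sup>2))"
      unfolding g_def using C hC[of \<theta>] h0[of \<theta>] le log_weight_far_le[OF t1] log_weight_pos[of \<theta>]
      by (intro mult_mono) (auto intro!: mult_nonneg_nonneg)
    also have "\<dots> = C / (norm \<theta> ^ ?D * (1 + ln (norm \<theta>))\<^sup>2)"
      using t0 by (simp add: field_simps)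
    finally show "ennreal (g \<theta>) * indicator (- ball 0 1) \<theta> \<le> ennreal (C / (norm \<theta> ^ ?D * (1 + ln (norm \<theta>))\<^sup>2))"
      by (simp add: indicator_def ennreal_leI)
  qed (rule C)
  moreover have "(\<integral>\<^sup>+\<theta>. ennreal (norm (g \<theta>)) \<partial>lborel) =
      (\<integral>\<^sup>+\<theta>. ennreal (g \<theta>) * indicator (ball 0 1) \<theta> \<partial>lborel) +
      (\<integral>\<^sup>+\<theta>. ennreal (g \<theta>) * indicator (- ball 0 1) \<theta> \<partial>lborel)"
    using g0 by (subst nn_integral_add[symmetric])
      (auto intro!: nn_integral_cong borel_measurable_times_ennreal borel_measurable_indicator simp: indicator_def)
  ultimately show "(\<integral>\<^sup>+\<theta>. ennreal (norm (h \<theta> * (a + (norm \<theta>)\<^sup>2) powr (- b) * log_weight \<theta>)) \<partial>lborel) < \<infinity>"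
    unfolding g_def by simp
qed measurable

section \<open>Formal posteriors of location models\<close>

text \<open>With \<open>s = t - t0\<close>, \<open>d = t0 - \<phi>\<close> and \<open>w = u - v\<close> the difference of the two sides of the
  first step is a perfect square, because \<open>u^2 - v^2 = 2 u w - w^2\<close>.\<close>

lemma weighted_loss_diff_le:
  fixes t t0 \<phi> u v B :: real
  assumes "\<bar>t\<bar> \<le> B" "\<bar>t0\<bar> \<le> B" "\<bar>\<phi>\<bar> \<le> B"
  shows "u\<^sup>2 * ((t0 - \<phi>)\<^sup>2 - (t - \<phi>)\<^sup>2) \<le> 24 * B\<^sup>2 * (u - v)\<^sup>2 + v\<^sup>2 * (2 * (t0 - t) * (t0 - \<phi>))"
proof -
  define s d w where "s = t - t0" and "d = t0 - \<phi>" and "w = u - v"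
  have sd: "\<bar>s\<bar> \<le> 2 * B" "\<bar>d\<bar> \<le> 2 * B" using assms by (auto simp: s_def d_def)
  have "u\<^sup>2 * ((t0 - \<phi>)\<^sup>2 - (t - \<phi>)\<^sup>2) + (s * u + 2 * d * w)\<^sup>2
      = (4 * d\<^sup>2 + 2 * (s * d)) * w\<^sup>2 + v\<^sup>2 * (2 * (t0 - t) * (t0 - \<phi>))"
    unfolding s_def d_def w_def by (simp add: power2_eq_square algebra_simps)
  then have "u\<^sup>2 * ((t0 - \<phi>)\<^sup>2 - (t - \<phi>)\<^sup>2)
      \<le> (4 * d\<^sup>2 + 2 * (s * d)) * w\<^sup>2 + v\<^sup>2 * (2 * (t0 - t) * (t0 - \<phi>))"
    by (smt (verit) zero_le_power2)
  \<comment> \<open>The constant is 4 (2B)^2 + 2 (2B)(2B).\<close>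
  also have "(4 * d\<^sup>2 + 2 * (s * d)) * w\<^sup>2 \<le> 24 * B\<^sup>2 * w\<^sup>2"
  proof (rule mult_right_mono)
    have "d\<^sup>2 \<le> (2 * B)\<^sup>2" using power_mono[OF sd(2), of 2] by simp
    moreover have "s * d \<le> (2 * B) * (2 * B)"
      using mult_mono[OF sd] sd by (simp add: abs_mult[symmetric])
    ultimately show "4 * d\<^sup>2 + 2 * (s * d) \<le> 24 * B\<^sup>2" by (simp add: power2_eq_square)
  qed simp
  finally show ?thesis by (simp add: w_def)
qed

text \<open>What the argument uses of the Gaussian kernel \<open>k\<close> and the prior density
  \<open>f\<close>. The order 4 in \<open>k_bound\<close> matches \<open>log_weight_lower\<close>
  and makes the marginal density finite; the order 6 in \<open>k_moment\<close> matches
  \<open>cutoff_diff_square_le\<close>; \<open>f_weight\<close> expresses recurrence;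
  \<open>f_nonzero\<close> makes the marginal density positive.\<close>

locale location_prior =
  fixes k f :: "'a::euclidean_space \<Rightarrow> real" and K :: real
  assumes k_measurable [measurable]: "k \<in> borel_measurable borel"
    and f_measurable [measurable]: "f \<in> borel_measurable borel"
    and k_pos: "\<And>z. 0 < k z"
    and f_nonneg: "\<And>\<theta>. 0 \<le> f \<theta>"
    and k_bound: "\<And>z. (1 + norm z) ^ 4 * k z \<le> K"
    and k_moment: "integrable lborel (\<lambda>z. (2 + norm z) ^ 6 * k z)"
    and f_weight: "integrable lborel (\<lambda>\<theta>. f \<theta> * log_weight \<theta>)"
    and f_nonzero: "\<not> (AE \<theta> in lborel. f \<theta> = 0)"
begin

definition model :: "'a \<Rightarrow> 'a measure" where
  "model \<theta> = density lborel (\<lambda>x. ennreal (k (x - \<theta>)))"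

definition prior :: "'a measure" where
  "prior = density lborel (\<lambda>\<theta>. ennreal (f \<theta>))"

definition marg :: "'a \<Rightarrow> real" where
  "marg x = (\<integral>\<theta>. f \<theta> * k (x - \<theta>) \<partial>lborel)"

lemma sets_prior [measurable_cong, simp]: "sets prior = sets borel"
  by (simp add: prior_def)

lemma space_prior [simp]: "space prior = UNIV"
  by (simp add: prior_def)

lemma joint_nonneg: "0 \<le> f \<theta> * k z"
  using f_nonneg[of \<theta>] k_pos[of z] by simp

lemma k_integrable: "integrable lborel k"
proof (rule Bochner_Integration.integrable_bound[OF k_moment])
  show "AE z in lborel. norm (k z) \<le> norm ((2 + norm z) ^ 6 * k z)"
  proof (rule AE_I2)
    fix z :: 'a
    have "1 \<le> (2 + norm z) ^ 6" by (intro one_le_power) simp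
    then show "norm (k z) \<le> norm ((2 + norm z) ^ 6 * k z)"
      using k_pos[of z] by (simp add: abs_mult mult_le_cancel_right1)
  qed
qed simp

text \<open>The marginal density is finite at every \<open>x\<close>: insert the factor
  \<open>(1 + norm \<theta>) ^ 4 * log_weight \<theta>\<close>, which is at least 1, and let the
  Peetre inequality distribute the fourth power over \<open>x\<close> and the kernel.\<close>

lemma joint_integrable: "integrable lborel (\<lambda>\<theta>. f \<theta> * k (x - \<theta>))"
proof (rule Bochner_Integration.integrable_bound)
  show "integrable lborel (\<lambda>\<theta>. (K * (1 + norm x) ^ 4) * (f \<theta> * log_weight \<theta>))"
    using f_weight by (rule integrable_mult_right)
  show "AE \<theta> in lborel. norm (f \<theta> * k (x - \<theta>)) \<le> norm ((K * (1 + norm x) ^ 4) * (f \<theta> * log_weight \<theta>))"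
  proof (rule AE_I2)
    fix \<theta> :: 'a
    let ?z = "x - \<theta>"
    have lw: "0 < log_weight \<theta>" by (rule log_weight_pos)
    have "k ?z \<le> k ?z * ((1 + norm \<theta>) ^ 4 * log_weight \<theta>)"
      using log_weight_lower[of \<theta>] k_pos[of ?z] by (simp add: mult_le_cancel_left1)
    also have "\<dots> \<le> k ?z * (((1 + norm x) * (1 + norm ?z)) ^ 4 * log_weight \<theta>)"
      using k_pos[of ?z] lw one_plus_norm_peetre[of \<theta> x]
      by (intro mult_left_mono mult_right_mono power_mono) (auto simp: less_imp_le)
    also have "\<dots> = ((1 + norm ?z) ^ 4 * k ?z) * ((1 + norm x) ^ 4 * log_weight \<theta>)"
      by (simp add: power_mult_distrib mult_ac)
    also have "\<dots> \<le> K * ((1 + norm x) ^ 4 * log_weight \<theta>)"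
      using lw by (intro mult_right_mono k_bound) (auto simp: less_imp_le)
    finally have "f \<theta> * k ?z \<le> f \<theta> * (K * ((1 + norm x) ^ 4 * log_weight \<theta>))"
      by (intro mult_left_mono f_nonneg)
    then show "norm (f \<theta> * k ?z) \<le> norm ((K * (1 + norm x) ^ 4) * (f \<theta> * log_weight \<theta>))"
      using joint_nonneg[of \<theta> ?z] by (simp add: mult_ac)
  qed
qed measurable

section \<open>The marginal density\<close>

lemma marg_measurable [measurable]: "marg \<in> borel_measurable borel"
  unfolding marg_def[abs_def] by measurable

text \<open>Since \<open>k\<close> is positive everywhere, a zero of the marginal density would
  force \<open>f = 0\<close> almost everywhere. Positivity at every \<open>x\<close> spares an
  exceptional set in the formula of Bayes.\<close>

lemma marg_pos: "0 < marg x"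
proof -
  have "marg x \<noteq> 0"
  proof
    assume "marg x = 0"
    then have "AE \<theta> in lborel. f \<theta> * k (x - \<theta>) = 0"
      unfolding marg_def using joint_nonneg joint_integrable
      by (subst (asm) integral_nonneg_eq_0_iff_AE) auto
    then have "AE \<theta> in lborel. f \<theta> = 0"
      by eventually_elim (use k_pos in \<open>auto simp: less_le\<close>)
    then show False using f_nonzero by simp
  qed
  moreover have "0 \<le> marg x"
    unfolding marg_def using joint_nonneg by (intro integral_nonneg_AE) auto
  ultimately show ?thesis by simp
qed

lemma nn_integral_joint: "(\<integral>\<^sup>+\<theta>. ennreal (f \<theta> * k (x - \<theta>)) \<partial>lborel) = ennreal (marg x)"
  unfolding marg_def using joint_integrable joint_nonneg by (intro nn_integral_eq_integral) auto

text \<open>Tonelli for the joint measure with a weight in \<open>\<theta>\<close>. The weight 1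
  gives the marginal, an indicator gives the posterior identity, and a general weight gives
  posterior means.\<close>

lemma prior_model_swap:
  assumes [measurable]: "g \<in> borel_measurable borel" "A \<in> sets borel"
  shows "(\<integral>\<^sup>+\<theta>. g \<theta> * emeasure (model \<theta>) A \<partial>prior) =
    (\<integral>\<^sup>+x. (\<integral>\<^sup>+\<theta>. g \<theta> * ennreal (f \<theta> * k (x - \<theta>)) \<partial>lborel) * indicator A x \<partial>lborel)"
proof -
  have em: "emeasure (model \<theta>) A = (\<integral>\<^sup>+x. ennreal (k (x - \<theta>)) * indicator A x \<partial>lborel)" for \<theta>
    unfolding model_def by (subst emeasure_density) auto
  have "(\<integral>\<^sup>+\<theta>. g \<theta> * emeasure (model \<theta>) A \<partial>prior) =
      (\<integral>\<^sup>+\<theta>. ennreal (f \<theta>) * (g \<theta> * (\<integral>\<^sup>+x. ennreal (k (x - \<theta>)) * indicator A x \<partial>lborel)) \<partial>lborel)"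
    unfolding prior_def em by (subst nn_integral_density) auto
  also have "\<dots> = (\<integral>\<^sup>+\<theta>. (\<integral>\<^sup>+x. g \<theta> * ennreal (f \<theta> * k (x - \<theta>)) * indicator A x \<partial>lborel) \<partial>lborel)"
  proof (rule nn_integral_cong)
    fix \<theta> :: 'a
    have "ennreal (f \<theta>) * (g \<theta> * (\<integral>\<^sup>+x. ennreal (k (x - \<theta>)) * indicator A x \<partial>lborel))
      = (\<integral>\<^sup>+x. (ennreal (f \<theta>) * g \<theta>) * (ennreal (k (x - \<theta>)) * indicator A x) \<partial>lborel)"
      by (subst nn_integral_cmult) (auto simp: mult_ac)
    also have "\<dots> = (\<integral>\<^sup>+x. g \<theta> * ennreal (f \<theta> * k (x - \<theta>)) * indicator A x \<partial>lborel)"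
      using f_nonneg k_pos by (intro nn_integral_cong) (simp add: ennreal_mult less_imp_le mult_ac)
    finally show "ennreal (f \<theta>) * (g \<theta> * (\<integral>\<^sup>+x. ennreal (k (x - \<theta>)) * indicator A x \<partial>lborel))
      = (\<integral>\<^sup>+x. g \<theta> * ennreal (f \<theta> * k (x - \<theta>)) * indicator A x \<partial>lborel)" .
  qed
  also have "\<dots> = (\<integral>\<^sup>+x. (\<integral>\<^sup>+\<theta>. g \<theta> * ennreal (f \<theta> * k (x - \<theta>)) * indicator A x \<partial>lborel) \<partial>lborel)"
    by (rule lborel_pair.Fubini'[symmetric]) measurable
  also have "\<dots> = (\<integral>\<^sup>+x. (\<integral>\<^sup>+\<theta>. g \<theta> * ennreal (f \<theta> * k (x - \<theta>)) \<partial>lborel) * indicator A x \<partial>lborel)"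
    by (intro nn_integral_cong) (subst nn_integral_multc, auto)
  finally show ?thesis .
qed

lemma marginal_eq: "marginal model prior lborel = density lborel (\<lambda>x. ennreal (marg x))"
  \<comment> \<open>Both sides become \<open>measure_of\<close> on the same sigma-algebra, so it
    suffices to compare the set functions.\<close>
  unfolding marginal_def density_def
proof (rule measure_of_eq)
  fix A assume "A \<in> sigma_sets (space lborel) (sets (lborel :: 'a measure))"
  then have [measurable]: "A \<in> sets borel"
    by (metis sets.sigma_sets_eq sets_lborel)
  have "(\<integral>\<^sup>+\<theta>. emeasure (model \<theta>) A \<partial>prior) = (\<integral>\<^sup>+\<theta>. 1 * emeasure (model \<theta>) A \<partial>prior)"
    by simp
  also have "\<dots> = (\<integral>\<^sup>+x. ennreal (marg x) * indicator A x \<partial>lborel)"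
    by (subst prior_model_swap) (auto simp: nn_integral_joint)
  finally show "(\<integral>\<^sup>+\<theta>. emeasure (model \<theta>) A \<partial>prior) = (\<integral>\<^sup>+x. ennreal (marg x) * indicator A x \<partial>lborel)" .
qed (rule sets.space_closed)

lemma sigma_finite_marginal: "sigma_finite_measure (marginal model prior lborel)"
  unfolding marginal_eq by (subst sigma_finite_measure.sigma_finite_iff_density_finite[OF sigma_finite_lborel]) auto

section \<open>Existence of a formal posterior and posterior means\<close>

lemma posterior_exists: "\<exists>Q. is_formal_posterior model prior lborel Q"
proof -
  define q where "q x \<theta> = ennreal (f \<theta> * k (x - \<theta>)) / ennreal (marg x)" for x \<theta>
  have [measurable]: "case_prod q \<in> borel_measurable (lborel \<Otimes>\<^sub>M lborel)"
    "\<And>x. q x \<in> borel_measurable borel"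
    unfolding q_def[abs_def] by measurable
  define Q where "Q x = density lborel (q x)" for x
  have Q_em: "emeasure (Q x) B = (\<integral>\<^sup>+\<theta>. q x \<theta> * indicator B \<theta> \<partial>lborel)" if "B \<in> sets borel" for x B
    unfolding Q_def using that by (subst emeasure_density) auto
  \<comment> \<open>The formula of Bayes cleared of its denominator. With \<open>B = UNIV\<close> it
    gives total mass one, with general \<open>B\<close> the joint identity.\<close>
  have Q_marg: "ennreal (marg x) * emeasure (Q x) B =
      (\<integral>\<^sup>+\<theta>. indicator B \<theta> * ennreal (f \<theta> * k (x - \<theta>)) \<partial>lborel)"
    if [measurable]: "B \<in> sets borel" for x B
  proof -
    have "ennreal (marg x) * emeasure (Q x) B = (\<integral>\<^sup>+\<theta>. ennreal (marg x) * (q x \<theta> * indicator B \<theta>) \<partial>lborel)"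
      unfolding Q_em[OF that] by (subst nn_integral_cmult) auto
    also have "\<dots> = (\<integral>\<^sup>+\<theta>. indicator B \<theta> * ennreal (f \<theta> * k (x - \<theta>)) \<partial>lborel)"
    proof (rule nn_integral_cong)
      fix \<theta> :: 'a
      have "ennreal (marg x) * q x \<theta> = ennreal (f \<theta> * k (x - \<theta>))"
        unfolding q_def using marg_pos[of x] joint_nonneg[of \<theta> "x - \<theta>"]
        by (simp add: divide_ennreal ennreal_mult[symmetric])
      then show "ennreal (marg x) * (q x \<theta> * indicator B \<theta>) = indicator B \<theta> * ennreal (f \<theta> * k (x - \<theta>))"
        by (simp add: mult.assoc[symmetric]) (simp add: mult.commute)
    qed
    finally show ?thesis .
  qed
  have "is_formal_posterior model prior lborel Q"
    unfolding is_formal_posterior_def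
  proof (intro conjI ballI)
    fix x :: 'a
    have "ennreal (marg x) * emeasure (Q x) UNIV = ennreal (marg x) * 1"
      by (subst Q_marg) (auto simp: nn_integral_joint)
    then have "emeasure (Q x) UNIV = 1"
      using marg_pos[of x] by (subst (asm) ennreal_mult_cancel_left) auto
    then show "prob_space (Q x)"
      by (intro prob_spaceI) (simp add: Q_def)
    show "sets (Q x) = sets prior" by (simp add: Q_def)
  next
    fix B assume "B \<in> sets prior"
    then have [measurable]: "B \<in> sets borel" by simp
    have "(\<lambda>x. \<integral>\<^sup>+\<theta>. q x \<theta> * indicator B \<theta> \<partial>lborel) \<in> borel_measurable lborel"
      by measurable
    then show "(\<lambda>x. emeasure (Q x) B) \<in> borel_measurable lborel"
      by (simp add: Q_em)
  next
    fix A B :: "'a set" assume "A \<in> sets lborel" "B \<in> sets prior"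
    then have [measurable]: "A \<in> sets borel" "B \<in> sets borel" by auto
    have [measurable]: "(\<lambda>x. emeasure (Q x) B) \<in> borel_measurable borel"
      by (simp add: Q_em)
    have "(\<integral>\<^sup>+\<theta>. indicator B \<theta> * emeasure (model \<theta>) A \<partial>prior) =
       (\<integral>\<^sup>+x. (ennreal (marg x) * emeasure (Q x) B) * indicator A x \<partial>lborel)"
      by (subst prior_model_swap) (auto simp: Q_marg)
    also have "\<dots> = (\<integral>\<^sup>+x. indicator A x * emeasure (Q x) B \<partial>marginal model prior lborel)"
      unfolding marginal_eq by (subst nn_integral_density) (auto simp: mult_ac)
    finally show "(\<integral>\<^sup>+\<theta>. indicator B \<theta> * emeasure (model \<theta>) A \<partial>prior) =
       (\<integral>\<^sup>+x. indicator A x * emeasure (Q x) B \<partial>marginal model prior lborel)" .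
  qed
  then show ?thesis by blast
qed

text \<open>Viewing the kernel as a map into \<open>subprob_algebra\<close> makes integrals against
  \<open>Q x\<close> measurable in \<open>x\<close>.\<close>

lemma posterior_measurable:
  assumes "is_formal_posterior model prior lborel Q"
  shows "Q \<in> measurable borel (subprob_algebra borel)"
proof (rule measurable_subprob_algebra)
  fix x
  show "subprob_space (Q x)" "sets (Q x) = sets borel"
    using assms unfolding is_formal_posterior_def by (auto intro: prob_space_imp_subprob_space)
next
  fix A :: "'a set" assume "A \<in> sets borel"
  then show "(\<lambda>x. emeasure (Q x) A) \<in> borel_measurable borel"
    using assms unfolding is_formal_posterior_def by auto
qed

text \<open>The defining identity on rectangles is the case of an indicator \<open>g\<close>;
  linearity and monotone limits extend it with \<open>A\<close> held fixed.\<close>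

lemma posterior_disintegration:
  assumes Q: "is_formal_posterior model prior lborel Q"
    and A [measurable]: "A \<in> sets borel" and g: "g \<in> borel_measurable borel"
  shows "(\<integral>\<^sup>+\<theta>. g \<theta> * emeasure (model \<theta>) A \<partial>prior) =
    (\<integral>\<^sup>+x. (\<integral>\<^sup>+\<theta>. g \<theta> \<partial>Q x) * (ennreal (marg x) * indicator A x) \<partial>lborel)"
  using g
proof induction
  note [measurable] = posterior_measurable[OF Q]
  have sQ: "sets (Q x) = sets borel" for x
    using Q unfolding is_formal_posterior_def by auto
  have mQ: "g \<in> borel_measurable (Q x) \<longleftrightarrow> g \<in> borel_measurable borel" for x and g :: "'a \<Rightarrow> ennreal"
    using measurable_cong_sets[OF sQ refl, of x "borel :: ennreal measure"] by simp
  have [measurable]: "(\<lambda>x. \<integral>\<^sup>+\<theta>. g \<theta> \<partial>Q x) \<in> borel_measurable borel"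
    if [measurable]: "g \<in> borel_measurable borel" for g :: "'a \<Rightarrow> ennreal"
    by measurable
  have [measurable]: "(\<lambda>\<theta>. emeasure (model \<theta>) A) \<in> borel_measurable borel"
    unfolding model_def by (subst emeasure_density) auto
  {
    case (cong g h)
    then have "g = h" by auto
    then show ?case using cong by simp
  next
    case (set B)
    then have [measurable]: "B \<in> sets borel" by simp
    have "(\<integral>\<^sup>+\<theta>. indicator B \<theta> * emeasure (model \<theta>) A \<partial>prior) =
        (\<integral>\<^sup>+x. indicator A x * emeasure (Q x) B \<partial>marginal model prior lborel)"
      using Q unfolding is_formal_posterior_def by auto
    also have "\<dots> = (\<integral>\<^sup>+x. ennreal (marg x) * (indicator A x * emeasure (Q x) B) \<partial>lborel)"
      unfolding marginal_eq by (subst nn_integral_density) auto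
    finally show ?case by (simp add: sQ mult_ac)
  next
    case (mult g c)
    note [measurable] = mult(2)
    have "(\<integral>\<^sup>+\<theta>. c * g \<theta> * emeasure (model \<theta>) A \<partial>prior) = c * (\<integral>\<^sup>+\<theta>. g \<theta> * emeasure (model \<theta>) A \<partial>prior)"
      by (subst nn_integral_cmult[symmetric]) (auto simp: mult.assoc)
    also have "\<dots> = (\<integral>\<^sup>+x. (\<integral>\<^sup>+\<theta>. c * g \<theta> \<partial>Q x) * (ennreal (marg x) * indicator A x) \<partial>lborel)"
      unfolding mult.IH
      by (subst nn_integral_cmult[symmetric]) (auto simp: nn_integral_cmult mQ mult.assoc)
    finally show ?case .
  next
    case (add g h)
    note [measurable] = add.hyps(1,3)
    have "(\<integral>\<^sup>+\<theta>. (h \<theta> + g \<theta>) * emeasure (model \<theta>) A \<partial>prior) =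
       (\<integral>\<^sup>+\<theta>. h \<theta> * emeasure (model \<theta>) A \<partial>prior) + (\<integral>\<^sup>+\<theta>. g \<theta> * emeasure (model \<theta>) A \<partial>prior)"
      by (subst nn_integral_add[symmetric]) (auto simp: distrib_right)
    also have "\<dots> = (\<integral>\<^sup>+x. (\<integral>\<^sup>+\<theta>. h \<theta> + g \<theta> \<partial>Q x) * (ennreal (marg x) * indicator A x) \<partial>lborel)"
      unfolding add.IH
      by (subst nn_integral_add[symmetric]) (auto simp: nn_integral_add mQ distrib_right)
    finally show ?case .
  next
    case (seq U)
    note [measurable] = seq.hyps(1)
    have inc: "incseq (\<lambda>i. U i \<theta>)" for \<theta>
      using \<open>incseq U\<close> by (auto simp: incseq_def le_fun_def)
    have incQ: "incseq (\<lambda>i. \<integral>\<^sup>+\<theta>. U i \<theta> \<partial>Q x)" for x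
      using inc by (auto simp: incseq_def intro!: nn_integral_mono)
    have "(\<integral>\<^sup>+\<theta>. (SUP i. U i) \<theta> * emeasure (model \<theta>) A \<partial>prior) =
       (\<integral>\<^sup>+\<theta>. (SUP i. U i \<theta> * emeasure (model \<theta>) A) \<partial>prior)"
      by (simp add: SUP_mult_right_ennreal image_comp)
    also have "\<dots> = (SUP i. \<integral>\<^sup>+\<theta>. U i \<theta> * emeasure (model \<theta>) A \<partial>prior)"
      using inc by (intro nn_integral_monotone_convergence_SUP)
        (auto simp: incseq_def le_fun_def intro!: mult_right_mono)
    also have "\<dots> = (SUP i. \<integral>\<^sup>+x. (\<integral>\<^sup>+\<theta>. U i \<theta> \<partial>Q x) * (ennreal (marg x) * indicator A x) \<partial>lborel)"
      unfolding seq.IH ..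
    also have "\<dots> = (\<integral>\<^sup>+x. (SUP i. (\<integral>\<^sup>+\<theta>. U i \<theta> \<partial>Q x) * (ennreal (marg x) * indicator A x)) \<partial>lborel)"
      using incQ by (intro nn_integral_monotone_convergence_SUP[symmetric])
        (auto simp: incseq_def le_fun_def intro!: mult_right_mono)
    also have "\<dots> = (\<integral>\<^sup>+x. (\<integral>\<^sup>+\<theta>. (SUP i. U i) \<theta> \<partial>Q x) * (ennreal (marg x) * indicator A x) \<partial>lborel)"
    proof -
      have "(\<integral>\<^sup>+\<theta>. (SUP i. U i \<theta>) \<partial>Q x) = (SUP i. \<integral>\<^sup>+\<theta>. U i \<theta> \<partial>Q x)" for x
        using \<open>incseq U\<close> by (rule nn_integral_monotone_convergence_SUP) (simp add: mQ seq.hyps(1))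
      moreover have "(SUP i. U i) = (\<lambda>\<theta>. SUP i. U i \<theta>)"
        by (simp add: fun_eq_iff image_comp)
      ultimately have "(\<integral>\<^sup>+\<theta>. (SUP i. U i) \<theta> \<partial>Q x) = (SUP i. \<integral>\<^sup>+\<theta>. U i \<theta> \<partial>Q x)" for x
        by (simp only:)
      then show ?thesis by (simp add: SUP_mult_right_ennreal)
    qed
    finally show ?case .
  }
qed

text \<open>Both sides are densities of the same measure in \<open>x\<close>, by
  \<open>posterior_disintegration\<close> and \<open>prior_model_swap\<close>, so they agree almost
  everywhere. In this way an arbitrary formal posterior is compared with the explicit joint
  density.\<close>

lemma posterior_mean_nonneg:
  assumes Q: "is_formal_posterior model prior lborel Q"
    and g [measurable]: "g \<in> borel_measurable borel"
  shows "AE x in lborel. ennreal (marg x) * (\<integral>\<^sup>+\<theta>. g \<theta> \<partial>Q x) =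
    (\<integral>\<^sup>+\<theta>. g \<theta> * ennreal (f \<theta> * k (x - \<theta>)) \<partial>lborel)"
proof -
  note [measurable] = posterior_measurable[OF Q]
  have "density lborel (\<lambda>x. ennreal (marg x) * (\<integral>\<^sup>+\<theta>. g \<theta> \<partial>Q x)) =
    density lborel (\<lambda>x. \<integral>\<^sup>+\<theta>. g \<theta> * ennreal (f \<theta> * k (x - \<theta>)) \<partial>lborel)" (is "?L = ?R")
  proof (rule measure_eqI)
    fix A assume "A \<in> sets ?L"
    then have [measurable]: "A \<in> sets borel" by simp
    show "emeasure ?L A = emeasure ?R A"
      using posterior_disintegration[OF Q, of A g] prior_model_swap[of g A]
      by (simp add: emeasure_density mult_ac)
  qed simp
  then show ?thesis
    by (intro sigma_finite_measure.density_unique sigma_finite_lborel) measurable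
qed

text \<open>The orthogonality that removes the linear term in the risk comparison: given
  \<open>x\<close>, the error of the posterior mean integrates to zero against the joint
  density.\<close>

lemma posterior_mean:
  assumes Q: "is_formal_posterior model prior lborel Q"
    and \<phi> [measurable]: "\<phi> \<in> borel_measurable borel" and B: "\<And>\<theta>. \<bar>\<phi> \<theta>\<bar> \<le> B"
  shows "AE x in lborel. (\<integral>\<theta>. (f \<theta> * k (x - \<theta>)) * ((\<integral>\<eta>. \<phi> \<eta> \<partial>Q x) - \<phi> \<theta>) \<partial>lborel) = 0"
proof -
  \<comment> \<open>Adding \<open>B\<close> makes the integrand nonnegative, so that the identity in
    \<open>ennreal\<close> applies; the summand \<open>marg x * B\<close> cancels
    afterwards.\<close>
  have "AE x in lborel. ennreal (marg x) * (\<integral>\<^sup>+\<theta>. ennreal (\<phi> \<theta> + B) \<partial>Q x) =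
    (\<integral>\<^sup>+\<theta>. ennreal (\<phi> \<theta> + B) * ennreal (f \<theta> * k (x - \<theta>)) \<partial>lborel)"
    by (rule posterior_mean_nonneg[OF Q]) measurable
  then show ?thesis
  proof eventually_elim
    case (elim x)
    interpret Qx: prob_space "Q x" using Q unfolding is_formal_posterior_def by auto
    have sQ[measurable_cong]: "sets (Q x) = sets borel"
      using Q unfolding is_formal_posterior_def by auto
    have nn: "0 \<le> \<phi> \<theta> + B" for \<theta> using B[of \<theta>] by linarith
    have B0: "0 \<le> B" using B[of 0] by linarith
    have iQ: "integrable (Q x) \<phi>"
      using B by (intro Qx.integrable_const_bound[where B = B]) auto
    have eQ: "(\<integral>\<theta>. \<phi> \<theta> + B \<partial>Q x) = (\<integral>\<theta>. \<phi> \<theta> \<partial>Q x) + B"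
      using iQ by (simp add: Qx.prob_space)
    have "0 \<le> (\<integral>\<theta>. \<phi> \<theta> + B \<partial>Q x)" using nn by (intro integral_nonneg_AE) auto
    then have eQ0: "0 \<le> (\<integral>\<theta>. \<phi> \<theta> \<partial>Q x) + B" using eQ by simp
    have i\<phi>: "integrable lborel (\<lambda>\<theta>. (f \<theta> * k (x - \<theta>)) * \<phi> \<theta>)"
    proof (rule Bochner_Integration.integrable_bound)
      show "integrable lborel (\<lambda>\<theta>. (f \<theta> * k (x - \<theta>)) * B)"
        using joint_integrable by (rule integrable_mult_left)
      show "AE \<theta> in lborel. norm (f \<theta> * k (x - \<theta>) * \<phi> \<theta>) \<le> norm (f \<theta> * k (x - \<theta>) * B)"
        using B B0 by (intro AE_I2) (auto simp: abs_mult intro!: mult_left_mono)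
    qed measurable
    have "ennreal (marg x) * ennreal (\<integral>\<theta>. \<phi> \<theta> + B \<partial>Q x) =
       (\<integral>\<^sup>+\<theta>. ennreal ((f \<theta> * k (x - \<theta>)) * \<phi> \<theta> + (f \<theta> * k (x - \<theta>)) * B) \<partial>lborel)"
      using elim iQ nn joint_nonneg
      by (subst nn_integral_eq_integral[symmetric]) (auto simp: ennreal_mult[symmetric] algebra_simps)
    also have "\<dots> = ennreal (\<integral>\<theta>. (f \<theta> * k (x - \<theta>)) * \<phi> \<theta> + (f \<theta> * k (x - \<theta>)) * B \<partial>lborel)"
    proof (rule nn_integral_eq_integral)
      show "AE \<theta> in lborel. 0 \<le> f \<theta> * k (x - \<theta>) * \<phi> \<theta> + f \<theta> * k (x - \<theta>) * B"
        using nn joint_nonneg by (auto simp: distrib_left[symmetric])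
    qed (use i\<phi> joint_integrable in auto)
    also have "(\<integral>\<theta>. (f \<theta> * k (x - \<theta>)) * \<phi> \<theta> + (f \<theta> * k (x - \<theta>)) * B \<partial>lborel) =
        (\<integral>\<theta>. (f \<theta> * k (x - \<theta>)) * \<phi> \<theta> \<partial>lborel) + marg x * B"
      using i\<phi> joint_integrable by (simp add: marg_def)
    also have "ennreal (marg x) * ennreal (\<integral>\<theta>. \<phi> \<theta> + B \<partial>Q x) = ennreal (marg x * ((\<integral>\<theta>. \<phi> \<theta> \<partial>Q x) + B))"
      using eQ eQ0 marg_pos[of x] by (simp add: ennreal_mult)
    finally have *: "ennreal (marg x * ((\<integral>\<theta>. \<phi> \<theta> \<partial>Q x) + B)) =
      ennreal ((\<integral>\<theta>. (f \<theta> * k (x - \<theta>)) * \<phi> \<theta> \<partial>lborel) + marg x * B)" .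
    have 1: "0 \<le> marg x * ((\<integral>\<theta>. \<phi> \<theta> \<partial>Q x) + B)"
      using eQ0 marg_pos[of x] by simp
    have "0 \<le> (\<integral>\<theta>. (f \<theta> * k (x - \<theta>)) * (\<phi> \<theta> + B) \<partial>lborel)"
      using nn joint_nonneg by (intro integral_nonneg_AE) auto
    then have 2: "0 \<le> (\<integral>\<theta>. (f \<theta> * k (x - \<theta>)) * \<phi> \<theta> \<partial>lborel) + marg x * B"
      using i\<phi> joint_integrable by (simp add: marg_def distrib_left)
    from * have "marg x * (\<integral>\<theta>. \<phi> \<theta> \<partial>Q x) = (\<integral>\<theta>. (f \<theta> * k (x - \<theta>)) * \<phi> \<theta> \<partial>lborel)"
      using 1 2 by (simp add: ennreal_inj distrib_left)
    then show ?case
      using i\<phi> joint_integrable by (simp add: marg_def right_diff_distrib)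
  qed
qed

section \<open>Blyth's method\<close>

lemma dominating_integrable:
  "integrable (lborel \<Otimes>\<^sub>M lborel)
    (\<lambda>(\<theta>, x). (f \<theta> * log_weight \<theta>) * ((2 + norm (x - \<theta>)) ^ 6 * k (x - \<theta>)))"
  by (rule integrable_lborel_pair_shift[OF f_weight k_moment])

lemma energy_bound:
  assumes "n > 0"
  shows "f \<theta> * k (x - \<theta>) * (cutoff n \<theta> - cutoff n x)\<^sup>2 \<le>
    (f \<theta> * log_weight \<theta>) * ((2 + norm (x - \<theta>)) ^ 6 * k (x - \<theta>))"
  using mult_left_mono[OF cutoff_diff_square_le[OF assms, of \<theta> x] joint_nonneg[of \<theta> "x - \<theta>"]]
  by (simp add: mult_ac)

lemma energy_integrable:
  assumes "n > 0"
  shows "integrable (lborel \<Otimes>\<^sub>M lborel)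
    (\<lambda>(\<theta>, x). f \<theta> * k (x - \<theta>) * (cutoff n \<theta> - cutoff n x)\<^sup>2)"
proof (rule Bochner_Integration.integrable_bound[OF dominating_integrable])
  show "AE p in lborel \<Otimes>\<^sub>M lborel.
      norm (case p of (\<theta>, x) \<Rightarrow> f \<theta> * k (x - \<theta>) * (cutoff n \<theta> - cutoff n x)\<^sup>2)
      \<le> norm (case p of (\<theta>, x) \<Rightarrow> f \<theta> * log_weight \<theta> * ((2 + norm (x - \<theta>)) ^ 6 * k (x - \<theta>)))"
  proof (rule AE_I2, clarsimp simp del: abs_mult)
    fix \<theta> x :: 'a
    show "\<bar>f \<theta> * k (x - \<theta>) * (cutoff n \<theta> - cutoff n x)\<^sup>2\<bar>
        \<le> \<bar>f \<theta> * log_weight \<theta> * ((2 + norm (x - \<theta>)) ^ 6 * k (x - \<theta>))\<bar>"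
      using energy_bound[OF assms, of \<theta> x] joint_nonneg[of \<theta> "x - \<theta>"]
        mult_nonneg_nonneg[OF joint_nonneg[of \<theta> "x - \<theta>"] zero_le_power2[of "cutoff n \<theta> - cutoff n x"]]
      by linarith
  qed
qed measurable

text \<open>Dominated convergence: both cutoffs tend to 1 pointwise, and the majorant does not
  depend on \<open>n\<close>.\<close>

lemma energy_tendsto:
  "(\<lambda>n. \<integral>(\<theta>, x). f \<theta> * k (x - \<theta>) * (cutoff (Suc n) \<theta> - cutoff (Suc n) x)\<^sup>2 \<partial>(lborel \<Otimes>\<^sub>M lborel)) \<longlonglongrightarrow> 0"
proof -
  have "(\<lambda>n. \<integral>p. (case p of (\<theta>, x) \<Rightarrow> f \<theta> * k (x - \<theta>) * (cutoff (Suc n) \<theta> - cutoff (Suc n) x)\<^sup>2) \<partial>(lborel \<Otimes>\<^sub>M lborel))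
     \<longlonglongrightarrow> (\<integral>p. (case p of (\<theta>, x) \<Rightarrow> f \<theta> * k (x - \<theta>) * (1 - 1)\<^sup>2) \<partial>(lborel \<Otimes>\<^sub>M lborel))"
  proof (rule integral_dominated_convergence[OF _ _ dominating_integrable])
    show "AE p in lborel \<Otimes>\<^sub>M lborel.
      (\<lambda>n. case p of (\<theta>, x) \<Rightarrow> f \<theta> * k (x - \<theta>) * (cutoff (Suc n) \<theta> - cutoff (Suc n) x)\<^sup>2)
        \<longlonglongrightarrow> (case p of (\<theta>, x) \<Rightarrow> f \<theta> * k (x - \<theta>) * (1 - 1)\<^sup>2)"
    proof (rule AE_I2, clarify)
      fix \<theta> x :: 'a
      show "(\<lambda>n. f \<theta> * k (x - \<theta>) * (cutoff (Suc n) \<theta> - cutoff (Suc n) x)\<^sup>2)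
        \<longlonglongrightarrow> f \<theta> * k (x - \<theta>) * (1 - 1)\<^sup>2"
        by (intro tendsto_intros LIMSEQ_Suc cutoff_tendsto)
    qed
    fix n
    show "AE p in lborel \<Otimes>\<^sub>M lborel.
      norm (case p of (\<theta>, x) \<Rightarrow> f \<theta> * k (x - \<theta>) * (cutoff (Suc n) \<theta> - cutoff (Suc n) x)\<^sup>2)
      \<le> (case p of (\<theta>, x) \<Rightarrow> f \<theta> * log_weight \<theta> * ((2 + norm (x - \<theta>)) ^ 6 * k (x - \<theta>)))"
    proof (rule AE_I2, clarify)
      fix \<theta> x :: 'a
      show "norm (f \<theta> * k (x - \<theta>) * (cutoff (Suc n) \<theta> - cutoff (Suc n) x)\<^sup>2)
        \<le> f \<theta> * log_weight \<theta> * ((2 + norm (x - \<theta>)) ^ 6 * k (x - \<theta>))"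
        using energy_bound[of "Suc n" \<theta> x] f_nonneg[of \<theta>] k_pos[of "x - \<theta>"] by (simp add: abs_mult)
    qed
  qed measurable
  then show ?thesis by simp
qed

text \<open>The joint measure weighted by the squared cutoff is finite, so that real integrals and
  Fubini are available for bounded factors.\<close>

lemma cutoff_left_integrable:
  assumes "n > 0"
  shows "integrable (lborel \<Otimes>\<^sub>M lborel) (\<lambda>(\<theta>, x). f \<theta> * k (x - \<theta>) * (cutoff n \<theta>)\<^sup>2)"
proof -
  have "integrable lborel (\<lambda>\<theta>. f \<theta> * (cutoff n \<theta>)\<^sup>2)"
  proof (rule Bochner_Integration.integrable_bound)
    show "integrable lborel (\<lambda>\<theta>. exp (4 * real n) * (f \<theta> * log_weight \<theta>))"
      using f_weight by (rule integrable_mult_right)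
    show "AE \<theta> in lborel. norm (f \<theta> * (cutoff n \<theta>)\<^sup>2) \<le> norm (exp (4 * real n) * (f \<theta> * log_weight \<theta>))"
    proof (rule AE_I2)
      fix \<theta> :: 'a
      show "norm (f \<theta> * (cutoff n \<theta>)\<^sup>2) \<le> norm (exp (4 * real n) * (f \<theta> * log_weight \<theta>))"
        using mult_left_mono[OF cutoff_square_le[OF assms, of \<theta>] f_nonneg[of \<theta>]]
          f_nonneg[of \<theta>] log_weight_pos[of \<theta>]
        by (simp add: abs_mult mult_ac)
    qed
  qed measurable
  from integrable_lborel_pair_shift[OF this k_integrable] show ?thesis
    by (simp add: mult_ac)
qed

lemma cutoff_right_integrable:
  assumes "n > 0"
  shows "integrable (lborel \<Otimes>\<^sub>M lborel) (\<lambda>(\<theta>, x). f \<theta> * k (x - \<theta>) * (cutoff n x)\<^sup>2)"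
proof (rule Bochner_Integration.integrable_bound)
  show "integrable (lborel \<Otimes>\<^sub>M lborel) (\<lambda>p.
      2 * (case p of (\<theta>, x) \<Rightarrow> f \<theta> * k (x - \<theta>) * (cutoff n \<theta>)\<^sup>2)
    + 2 * (case p of (\<theta>, x) \<Rightarrow> f \<theta> * k (x - \<theta>) * (cutoff n \<theta> - cutoff n x)\<^sup>2))"
    by (intro Bochner_Integration.integrable_add integrable_mult_right
        cutoff_left_integrable energy_integrable assms)
  show "AE p in lborel \<Otimes>\<^sub>M lborel. norm (case p of (\<theta>, x) \<Rightarrow> f \<theta> * k (x - \<theta>) * (cutoff n x)\<^sup>2)
    \<le> norm (2 * (case p of (\<theta>, x) \<Rightarrow> f \<theta> * k (x - \<theta>) * (cutoff n \<theta>)\<^sup>2)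
    + 2 * (case p of (\<theta>, x) \<Rightarrow> f \<theta> * k (x - \<theta>) * (cutoff n \<theta> - cutoff n x)\<^sup>2))"
  proof (rule AE_I2, clarify)
    fix \<theta> x :: 'a
    let ?j = "f \<theta> * k (x - \<theta>)" and ?u = "cutoff n \<theta>" and ?v = "cutoff n x"
    \<comment> \<open>This square is exactly 2 u^2 + 2 (u - v)^2 - v^2; it reduces the cutoff at
      \<open>x\<close> to the cutoff at \<open>\<theta>\<close> and the energy.\<close>
    have "0 \<le> (2 * ?u - ?v)\<^sup>2" by simp
    then have "?v\<^sup>2 \<le> 2 * ?u\<^sup>2 + 2 * (?u - ?v)\<^sup>2" by (simp add: power2_eq_square algebra_simps)
    from mult_left_mono[OF this joint_nonneg[of \<theta> "x - \<theta>"]]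
    have "?j * ?v\<^sup>2 \<le> 2 * (?j * ?u\<^sup>2) + 2 * (?j * (?u - ?v)\<^sup>2)" by (simp add: algebra_simps)
    moreover have "0 \<le> ?j * ?v\<^sup>2" using joint_nonneg[of \<theta> "x - \<theta>"] by simp
    ultimately show "norm (?j * ?v\<^sup>2) \<le> norm (2 * (?j * ?u\<^sup>2) + 2 * (?j * (?u - ?v)\<^sup>2))" by simp
  qed
qed measurable

section \<open>Comparison of risks with the formal Bayes estimator\<close>

lemma bounded_estimator_risk:
  fixes t \<phi> :: "'a \<Rightarrow> real"
  assumes [measurable]: "t \<in> borel_measurable borel" and t: "\<And>x. \<bar>t x\<bar> \<le> B" and \<phi>: "\<And>\<theta>. \<bar>\<phi> \<theta>\<bar> \<le> B"
  shows "integrable lborel (\<lambda>x. k (x - \<theta>) * (t x - \<phi> \<theta>)\<^sup>2)"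
    and "risk model \<phi> t \<theta> = ennreal (\<integral>x. k (x - \<theta>) * (t x - \<phi> \<theta>)\<^sup>2 \<partial>lborel)"
proof -
  show i: "integrable lborel (\<lambda>x. k (x - \<theta>) * (t x - \<phi> \<theta>)\<^sup>2)"
  proof (rule integrable_mult_bounded[OF integrable_lborel_shift(1)[OF k_integrable]])
    fix x
    have "\<bar>t x - \<phi> \<theta>\<bar> \<le> 2 * B" using t[of x] \<phi>[of \<theta>] by linarith
    from power_mono[OF this, of 2] show "\<bar>(t x - \<phi> \<theta>)\<^sup>2\<bar> \<le> (2 * B)\<^sup>2" by simp
  qed measurable
  have "risk model \<phi> t \<theta> = (\<integral>\<^sup>+x. ennreal (k (x - \<theta>)) * ennreal ((t x - \<phi> \<theta>)\<^sup>2) \<partial>lborel)"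
    unfolding risk_def model_def by (subst nn_integral_density) auto
  also have "\<dots> = (\<integral>\<^sup>+x. ennreal (k (x - \<theta>) * (t x - \<phi> \<theta>)\<^sup>2) \<partial>lborel)"
    using k_pos by (simp add: ennreal_mult less_imp_le)
  also have "\<dots> = ennreal (\<integral>x. k (x - \<theta>) * (t x - \<phi> \<theta>)\<^sup>2 \<partial>lborel)"
    using i k_pos by (intro nn_integral_eq_integral) (auto simp: less_imp_le)
  finally show "risk model \<phi> t \<theta> = ennreal (\<integral>x. k (x - \<theta>) * (t x - \<phi> \<theta>)\<^sup>2 \<partial>lborel)" .
qed

lemma bounded_estimator_not_better:
  assumes Q: "is_formal_posterior model prior lborel Q"
    and \<phi> [measurable]: "\<phi> \<in> borel_measurable borel" and \<phi>B: "\<And>\<theta>. \<bar>\<phi> \<theta>\<bar> \<le> B"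
    and t [measurable]: "t \<in> borel_measurable borel" and tB: "\<And>x. \<bar>t x\<bar> \<le> B"
    and le: "\<And>\<theta>. risk model \<phi> t \<theta> \<le> risk model \<phi> (\<lambda>x. \<integral>\<eta>. \<phi> \<eta> \<partial>Q x) \<theta>"
  shows "AE \<theta> in prior. risk model \<phi> t \<theta> = risk model \<phi> (\<lambda>x. \<integral>\<eta>. \<phi> \<eta> \<partial>Q x) \<theta>"
proof -
  note [measurable] = posterior_measurable[OF Q]
  define t0 where "t0 x = (\<integral>\<eta>. \<phi> \<eta> \<partial>Q x)" for x
  have t0_meas [measurable]: "t0 \<in> borel_measurable borel" unfolding t0_def[abs_def] by measurable
  have t0B: "\<bar>t0 x\<bar> \<le> B" for x
  proof -
    interpret Qx: prob_space "Q x" using Q unfolding is_formal_posterior_def by auto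
    have [measurable_cong]: "sets (Q x) = sets borel"
      using Q unfolding is_formal_posterior_def by auto
    have i: "integrable (Q x) \<phi>"
      using \<phi>B by (intro Qx.integrable_const_bound[where B = B]) auto
    have "- B \<le> \<phi> \<eta>" "\<phi> \<eta> \<le> B" for \<eta> using \<phi>B[of \<eta>] by linarith+
    then have "t0 x \<le> B" "- B \<le> t0 x"
      unfolding t0_def using i by (auto intro!: Qx.integral_le_const Qx.integral_ge_const)
    then show ?thesis by linarith
  qed
  note R = bounded_estimator_risk[where \<phi> = \<phi>, OF t tB \<phi>B] and R0 = bounded_estimator_risk[where \<phi> = \<phi>, OF t0_meas t0B \<phi>B]
  \<comment> \<open>\<open>e\<close> is the gain in loss of \<open>t\<close> over \<open>t0\<close>,
    and \<open>d\<close> the resulting gain in risk, nonnegative because \<open>t\<close>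
    dominates.\<close>
  define e where "e \<theta> x = (t0 x - \<phi> \<theta>)\<^sup>2 - (t x - \<phi> \<theta>)\<^sup>2" for \<theta> x
  define d where "d \<theta> = (\<integral>x. k (x - \<theta>) * e \<theta> x \<partial>lborel)" for \<theta>
  have d_eq: "d \<theta> = (\<integral>x. k (x - \<theta>) * (t0 x - \<phi> \<theta>)\<^sup>2 \<partial>lborel) - (\<integral>x. k (x - \<theta>) * (t x - \<phi> \<theta>)\<^sup>2 \<partial>lborel)" for \<theta>
    unfolding d_def e_def right_diff_distrib using R R0 by simp
  have d_nonneg: "0 \<le> d \<theta>" for \<theta>
  proof -
    have "0 \<le> (\<integral>x. k (x - \<theta>) * (t0 x - \<phi> \<theta>)\<^sup>2 \<partial>lborel)"
      using k_pos by (intro integral_nonneg_AE) (auto simp: less_imp_le)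
    then show ?thesis
      using le[of \<theta>] unfolding t0_def[symmetric] d_eq R(2) R0(2) by (simp add: ennreal_le_iff)
  qed
  have e_meas [measurable]: "case_prod e \<in> borel_measurable (borel \<Otimes>\<^sub>M borel)"
    unfolding e_def[abs_def] by measurable
  have d_meas [measurable]: "d \<in> borel_measurable borel"
    unfolding d_def[abs_def] by measurable
  have B0: "0 \<le> B" using \<phi>B[of 0] by linarith
  have eB: "\<bar>e \<theta> x\<bar> \<le> 4 * B\<^sup>2" for \<theta> x
  proof -
    have "(t0 x - \<phi> \<theta>)\<^sup>2 \<le> (2 * B)\<^sup>2" "(t x - \<phi> \<theta>)\<^sup>2 \<le> (2 * B)\<^sup>2"
      using power_mono[of "\<bar>t0 x - \<phi> \<theta>\<bar>" "2 * B" 2] power_mono[of "\<bar>t x - \<phi> \<theta>\<bar>" "2 * B" 2]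
        t0B[of x] tB[of x] \<phi>B[of \<theta>] by auto
    moreover have "(2 * B)\<^sup>2 = 4 * B\<^sup>2" by (simp add: power2_eq_square)
    moreover have "0 \<le> (t0 x - \<phi> \<theta>)\<^sup>2" "0 \<le> (t x - \<phi> \<theta>)\<^sup>2" by simp_all
    ultimately show ?thesis unfolding e_def by linarith
  qed
  define L where "L \<theta> x = 2 * (t0 x - t x) * (t0 x - \<phi> \<theta>)" for \<theta> x
  have L_meas [measurable]: "case_prod L \<in> borel_measurable (borel \<Otimes>\<^sub>M borel)"
    unfolding L_def[abs_def] by measurable
  have LB: "\<bar>L \<theta> x\<bar> \<le> 2 * (2 * B) * (2 * B)" for \<theta> x
    unfolding L_def abs_mult using t0B[of x] tB[of x] \<phi>B[of \<theta>] B0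
    by (intro mult_mono) auto
  define E where "E n = (\<integral>(\<theta>, x). f \<theta> * k (x - \<theta>) * (cutoff (Suc n) \<theta> - cutoff (Suc n) x)\<^sup>2 \<partial>(lborel \<Otimes>\<^sub>M lborel))" for n
  have key: "(\<integral>\<^sup>+\<theta>. ennreal (f \<theta> * (cutoff (Suc n) \<theta>)\<^sup>2 * d \<theta>) \<partial>lborel) \<le> ennreal (24 * B\<^sup>2 * E n)" for n
  proof -
    let ?u = "\<lambda>\<theta>. cutoff (Suc n) \<theta> :: real" and ?j = "\<lambda>\<theta> x. f \<theta> * k (x - \<theta>)"
    let ?P = "lborel \<Otimes>\<^sub>M lborel :: ('a \<times> 'a) measure"
    have i1: "integrable ?P (\<lambda>(\<theta>, x). ?j \<theta> x * (?u \<theta>)\<^sup>2 * e \<theta> x)"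
      using integrable_mult_bounded[OF cutoff_left_integrable[of "Suc n"], of "case_prod e" "4 * B\<^sup>2"] eB
      by (simp add: case_prod_beta' e_meas[unfolded case_prod_beta'])
    have i2: "integrable ?P (\<lambda>(\<theta>, x). ?j \<theta> x * (?u x)\<^sup>2 * L \<theta> x)"
      using integrable_mult_bounded[OF cutoff_right_integrable[of "Suc n"], of "case_prod L" "2 * (2 * B) * (2 * B)"] LB
      by (simp add: case_prod_beta' L_meas[unfolded case_prod_beta'])
    have i3: "integrable ?P (\<lambda>(\<theta>, x). ?j \<theta> x * (?u \<theta> - ?u x)\<^sup>2)"
      by (rule energy_integrable) simp
    \<comment> \<open>The cutoff here depends on \<open>x\<close> alone, so for fixed
      \<open>x\<close> everything but \<open>t0 x - \<phi> \<theta>\<close> and the joint density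
      leaves the inner integral, which then vanishes by \<open>posterior_mean\<close>.\<close>
    have zero: "(\<integral>(\<theta>, x). ?j \<theta> x * (?u x)\<^sup>2 * L \<theta> x \<partial>?P) = 0"
    proof -
      have "(\<integral>(\<theta>, x). ?j \<theta> x * (?u x)\<^sup>2 * L \<theta> x \<partial>?P)
          = (\<integral>x. (\<integral>\<theta>. ?j \<theta> x * (?u x)\<^sup>2 * L \<theta> x \<partial>lborel) \<partial>lborel)"
        by (rule lborel_pair.integral_snd[OF i2, symmetric])
      also have "\<dots> = (\<integral>x. 0 \<partial>(lborel :: 'a measure))"
      proof (rule integral_cong_AE)
        show "AE x in lborel. (\<integral>\<theta>. ?j \<theta> x * (?u x)\<^sup>2 * L \<theta> x \<partial>lborel) = 0"
          using posterior_mean[OF Q \<phi> \<phi>B]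
        proof eventually_elim
          case (elim x)
          have "(\<integral>\<theta>. ?j \<theta> x * (?u x)\<^sup>2 * L \<theta> x \<partial>lborel)
             = (\<integral>\<theta>. ((?u x)\<^sup>2 * 2 * (t0 x - t x)) * (?j \<theta> x * (t0 x - \<phi> \<theta>)) \<partial>lborel)"
            by (intro Bochner_Integration.integral_cong) (auto simp: L_def)
          also have "\<dots> = ((?u x)\<^sup>2 * 2 * (t0 x - t x)) * (\<integral>\<theta>. ?j \<theta> x * (t0 x - \<phi> \<theta>) \<partial>lborel)"
            by (rule integral_mult_right_zero)
          finally show ?case using elim by (simp add: t0_def)
        qed
      qed measurable
      finally show ?thesis by simp
    qed
    have inner: "(\<integral>x. ?j \<theta> x * (?u \<theta>)\<^sup>2 * e \<theta> x \<partial>lborel) = f \<theta> * (?u \<theta>)\<^sup>2 * d \<theta>" for \<theta>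
    proof -
      have "(\<integral>x. ?j \<theta> x * (?u \<theta>)\<^sup>2 * e \<theta> x \<partial>lborel) = (\<integral>x. (f \<theta> * (?u \<theta>)\<^sup>2) * (k (x - \<theta>) * e \<theta> x) \<partial>lborel)"
        by (intro Bochner_Integration.integral_cong) auto
      also have "\<dots> = f \<theta> * (?u \<theta>)\<^sup>2 * d \<theta>"
        unfolding d_def by (rule integral_mult_right_zero)
      finally show ?thesis .
    qed
    have "(\<integral>\<theta>. f \<theta> * (?u \<theta>)\<^sup>2 * d \<theta> \<partial>lborel) = (\<integral>\<theta>. (\<integral>x. ?j \<theta> x * (?u \<theta>)\<^sup>2 * e \<theta> x \<partial>lborel) \<partial>lborel)"
      by (simp only: inner)
    also have "\<dots> = (\<integral>(\<theta>, x). ?j \<theta> x * (?u \<theta>)\<^sup>2 * e \<theta> x \<partial>?P)"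
      by (rule lborel_pair.integral_fst[OF i1])
    also have "\<dots> \<le> (\<integral>p. 24 * B\<^sup>2 * (case p of (\<theta>, x) \<Rightarrow> ?j \<theta> x * (?u \<theta> - ?u x)\<^sup>2)
          + (case p of (\<theta>, x) \<Rightarrow> ?j \<theta> x * (?u x)\<^sup>2 * L \<theta> x) \<partial>?P)"
    proof (rule integral_mono[OF i1])
      show "integrable ?P (\<lambda>p. 24 * B\<^sup>2 * (case p of (\<theta>, x) \<Rightarrow> ?j \<theta> x * (?u \<theta> - ?u x)\<^sup>2)
          + (case p of (\<theta>, x) \<Rightarrow> ?j \<theta> x * (?u x)\<^sup>2 * L \<theta> x))"
        by (intro Bochner_Integration.integrable_add integrable_mult_right i2 i3)
      fix p :: "'a \<times> 'a"
      obtain \<theta> x where p: "p = (\<theta>, x)" by force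
      show "(case p of (\<theta>, x) \<Rightarrow> ?j \<theta> x * (?u \<theta>)\<^sup>2 * e \<theta> x) \<le>
         24 * B\<^sup>2 * (case p of (\<theta>, x) \<Rightarrow> ?j \<theta> x * (?u \<theta> - ?u x)\<^sup>2)
          + (case p of (\<theta>, x) \<Rightarrow> ?j \<theta> x * (?u x)\<^sup>2 * L \<theta> x)"
        using mult_left_mono[OF weighted_loss_diff_le[OF tB t0B \<phi>B, of "?u \<theta>" x \<theta> x "?u x"]
            joint_nonneg[of \<theta> "x - \<theta>"]]
        unfolding p e_def L_def by (simp add: algebra_simps)
    qed
    also have "\<dots> = 24 * B\<^sup>2 * E n"
      using i2 i3 zero by (simp add: E_def)
    finally have le: "(\<integral>\<theta>. f \<theta> * (?u \<theta>)\<^sup>2 * d \<theta> \<partial>lborel) \<le> 24 * B\<^sup>2 * E n" .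
    have "integrable lborel (\<lambda>\<theta>. f \<theta> * (?u \<theta>)\<^sup>2 * d \<theta>)"
      using lborel_pair.integrable_fst'[OF i1] by (simp only: prod.case inner)
    then have "(\<integral>\<^sup>+\<theta>. ennreal (f \<theta> * (?u \<theta>)\<^sup>2 * d \<theta>) \<partial>lborel) = ennreal (\<integral>\<theta>. f \<theta> * (?u \<theta>)\<^sup>2 * d \<theta> \<partial>lborel)"
      using f_nonneg d_nonneg by (intro nn_integral_eq_integral) auto
    then show ?thesis using le by (simp add: ennreal_leI)
  qed
  have lim: "(\<lambda>n. ennreal (24 * B\<^sup>2 * E n)) \<longlonglongrightarrow> 0"
    using tendsto_ennrealI[OF tendsto_mult_right_zero[OF energy_tendsto, of "24 * B\<^sup>2"]]
    by (simp add: E_def)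
  \<comment> \<open>Fatou: the squared cutoffs tend to 1, so the total gain is at most the lower
    limit of the weighted gains, which the vanishing energy controls.\<close>
  have "(\<integral>\<^sup>+\<theta>. ennreal (f \<theta> * d \<theta>) \<partial>lborel)
      = (\<integral>\<^sup>+\<theta>. liminf (\<lambda>n. ennreal (f \<theta> * (cutoff (Suc n) \<theta>)\<^sup>2 * d \<theta>)) \<partial>lborel)"
  proof (rule nn_integral_cong)
    fix \<theta> :: 'a
    have "(\<lambda>n. f \<theta> * (cutoff (Suc n) \<theta>)\<^sup>2 * d \<theta>) \<longlonglongrightarrow> f \<theta> * 1\<^sup>2 * d \<theta>"
      by (intro tendsto_intros LIMSEQ_Suc cutoff_tendsto)
    from lim_imp_Liminf[OF _ tendsto_ennrealI[OF this]]
    show "ennreal (f \<theta> * d \<theta>) = liminf (\<lambda>n. ennreal (f \<theta> * (cutoff (Suc n) \<theta>)\<^sup>2 * d \<theta>))"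
      by simp
  qed
  also have "\<dots> \<le> liminf (\<lambda>n. \<integral>\<^sup>+\<theta>. ennreal (f \<theta> * (cutoff (Suc n) \<theta>)\<^sup>2 * d \<theta>) \<partial>lborel)"
    by (rule nn_integral_liminf) measurable
  also have "\<dots> \<le> liminf (\<lambda>n. ennreal (24 * B\<^sup>2 * E n))"
    by (intro Liminf_mono always_eventually allI key)
  also have "\<dots> = 0" using lim by (intro lim_imp_Liminf) auto
  finally have "(\<integral>\<^sup>+\<theta>. ennreal (f \<theta> * d \<theta>) \<partial>lborel) = 0" by simp
  then have "AE \<theta> in lborel. ennreal (f \<theta> * d \<theta>) = 0"
    by (subst (asm) nn_integral_0_iff_AE) auto
  then have "AE \<theta> in lborel. 0 < ennreal (f \<theta>) \<longrightarrow> d \<theta> = 0"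
    by eventually_elim (use d_nonneg in \<open>auto simp: ennreal_eq_0_iff mult_le_0_iff dual_order.antisym\<close>)
  then have "AE \<theta> in prior. d \<theta> = 0"
    unfolding prior_def by (subst AE_density) auto
  then show ?thesis
    by eventually_elim (simp add: d_eq R(2) R0(2) t0_def[symmetric])
qed

theorem strongly_admissible_prior: "strongly_admissible model prior lborel"
  unfolding strongly_admissible_def
proof (intro conjI allI impI ballI)
  show "sigma_finite_measure (marginal model prior lborel)" by (rule sigma_finite_marginal)
  show "\<exists>Q. is_formal_posterior model prior lborel Q" by (rule posterior_exists)
  fix Q and \<phi> :: "'a \<Rightarrow> real"
  assume Q: "is_formal_posterior model prior lborel Q"
    and "\<phi> \<in> borel_measurable prior" and bdd: "\<exists>B. \<forall>\<theta>\<in>space prior. \<bar>\<phi> \<theta>\<bar> \<le> B"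
  then have \<phi>: "\<phi> \<in> borel_measurable borel" by simp
  from bdd obtain B where B: "\<And>\<theta>. \<bar>\<phi> \<theta>\<bar> \<le> B" by auto
  show "almost_admissible model prior lborel \<phi> (\<lambda>x. \<integral>\<theta>. \<phi> \<theta> \<partial>Q x)"
    unfolding almost_admissible_def
  proof (intro ballI impI)
    fix t :: "'a \<Rightarrow> real"
    assume "t \<in> borel_measurable lborel"
      and le: "\<forall>\<theta>\<in>space prior. risk model \<phi> t \<theta> \<le> risk model \<phi> (\<lambda>x. \<integral>\<theta>. \<phi> \<theta> \<partial>Q x) \<theta>"
    then have [measurable]: "t \<in> borel_measurable borel" by simp
    \<comment> \<open>Projection onto an interval containing all values of \<open>\<phi>\<close>
      brings the estimate no farther from \<open>\<phi> \<theta>\<close>, so \<open>t'\<close> still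
      dominates and is bounded.\<close>
    define t' where "t' x = max (- B) (min B (t x))" for x
    have B0: "0 \<le> B" using B[of 0] by linarith
    have t'_meas: "t' \<in> borel_measurable borel" unfolding t'_def[abs_def] by measurable
    have t'B: "\<bar>t' x\<bar> \<le> B" for x using B0 by (auto simp: t'_def)
    have t'_le: "risk model \<phi> t' \<theta> \<le> risk model \<phi> t \<theta>" for \<theta>
      unfolding risk_def
    proof (intro nn_integral_mono ennreal_leI)
      fix x
      have "\<bar>t' x - \<phi> \<theta>\<bar> \<le> \<bar>t x - \<phi> \<theta>\<bar>" using B[of \<theta>] unfolding t'_def by linarith
      then show "(t' x - \<phi> \<theta>)\<^sup>2 \<le> (t x - \<phi> \<theta>)\<^sup>2" by (simp add: abs_le_square_iff)
    qed
    have "AE \<theta> in prior. risk model \<phi> t' \<theta> = risk model \<phi> (\<lambda>x. \<integral>\<theta>. \<phi> \<theta> \<partial>Q x) \<theta>"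
      using le t'_le by (intro bounded_estimator_not_better[OF Q \<phi> B t'_meas t'B]) (auto intro: order_trans)
    \<comment> \<open>The risk of \<open>t\<close> lies between that of \<open>t'\<close> and that
      of the Bayes estimator, which agree almost everywhere.\<close>
    then show "AE \<theta> in prior. \<not> risk model \<phi> t \<theta> < risk model \<phi> (\<lambda>x. \<integral>\<theta>. \<phi> \<theta> \<partial>Q x) \<theta>"
      by eventually_elim (use t'_le in \<open>metis leD\<close>)
  qed
qed

end

section \<open>Gaussian models\<close>

theorem theorem5p2:
  fixes h :: "real^'n \<Rightarrow> real" and a b :: real
  assumes p3: "CARD('n) \<ge> 3"
    and a_nonneg: "a \<ge> 0" and b_pos: "b > 0"
    and h_meas: "h \<in> borel_measurable borel"
    and h_nonneg: "\<And>\<theta>. h \<theta> \<ge> 0"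
    and h_bdd: "\<exists>C. \<forall>\<theta>. h \<theta> \<le> C"
    and improper: "emeasure (prior_hab h a b) UNIV = \<infinity>"
    and ab: "(a > 0 \<and> real CARD('n) / 2 - 1 \<le> b \<and> b \<le> real CARD('n) / 2)
           \<or> (a = 0 \<and> real CARD('n) / 2 - 1 \<le> b \<and> b < real CARD('n) / 2)"
  shows "strongly_admissible gauss_model (prior_hab h a b) lborel"
proof -
  define c where "c = (2 * pi) powr (- real CARD('n) / 2)"
  define k where "k z = c * exp (- (norm z)\<^sup>2 / 2)" for z :: "real^'n"
  define f where "f \<theta> = h \<theta> * (a + (norm \<theta>)\<^sup>2) powr (- b)" for \<theta> :: "real^'n"
  note [measurable] = h_meas
  have c: "0 < c" by (simp add: c_def)
  obtain C where C: "\<And>\<theta>. h \<theta> \<le> C" using h_bdd by blast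
  \<comment> \<open>The constant comes from \<open>polynomial_gaussian_le\<close> with exponent
    4.\<close>
  interpret location_prior k f "c * exp (2 * real 4 + (real 4)\<^sup>2 / 2)"
  proof
    show "k \<in> borel_measurable borel" unfolding k_def[abs_def] by measurable
    show f_meas: "f \<in> borel_measurable borel" unfolding f_def[abs_def] by measurable
    show "0 < k z" for z using c by (simp add: k_def)
    show "0 \<le> f \<theta>" for \<theta> using h_nonneg[of \<theta>] by (simp add: f_def)
    show "(1 + norm z) ^ 4 * k z \<le> c * exp (2 * real 4 + (real 4)\<^sup>2 / 2)" for z
    proof -
      have "(1 + norm z) ^ 4 * k z \<le> (2 + norm z) ^ 4 * k z"
        using c by (intro mult_right_mono power_mono) (auto simp: k_def)
      also have "\<dots> = c * ((2 + norm z) ^ 4 * exp (- (norm z)\<^sup>2 / 2))" by (simp add: k_def)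
      also have "\<dots> \<le> c * exp (2 * real 4 + (real 4)\<^sup>2 / 2)"
        using c by (intro mult_left_mono polynomial_gaussian_le) auto
      finally show ?thesis .
    qed
    show "integrable lborel (\<lambda>z. (2 + norm z) ^ 6 * k z)"
      unfolding k_def using c by (intro gaussian_moment_integrable) simp
    show "integrable lborel (\<lambda>\<theta>. f \<theta> * log_weight \<theta>)"
      unfolding f_def using ab a_nonneg b_pos
      by (intro prior_weight_integrable[OF h_meas h_nonneg C]) (auto simp: field_simps)
    \<comment> \<open>A density vanishing almost everywhere would have total mass zero, against the
      impropriety of the prior.\<close>
    show "\<not> (AE \<theta> in lborel. f \<theta> = 0)"
    proof
      assume "AE \<theta> in lborel. f \<theta> = 0"
      then have "(\<integral>\<^sup>+\<theta>. ennreal (f \<theta>) \<partial>lborel) = 0"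
        using f_meas by (subst nn_integral_0_iff_AE) auto
      moreover have "emeasure (prior_hab h a b) UNIV = (\<integral>\<^sup>+\<theta>. ennreal (f \<theta>) \<partial>lborel)"
        unfolding prior_hab_def f_def by (subst emeasure_density) auto
      ultimately show False using improper by simp
    qed
  qed
  have "model = gauss_model"
    unfolding model_def gauss_model_def k_def c_def fun_eq_iff by simp
  moreover have "prior = prior_hab h a b"
    unfolding prior_def prior_hab_def f_def by simp
  ultimately show ?thesis using strongly_admissible_prior by simp
qed

end
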